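(* Let $d\ge 2$. Up to an orthogonal transformation of $\mathbb{R}^d$, every local minimum of the logarithmic energy $E_{\log}(X)$ over configurations $X$ of $d+2$ distinct points on $\mathbb{S}^{d-1}$ consists of (the vertices of) two regular simplexes of cardinality $m\ge n>1$, $m+n=d+2$, such that these two simplexes are orthogonal to each other. The global minimum of $E_{\log}$ over such configurations occurs when $m=n$ if $d$ is even, and when $m=n+1$ if $d$ is odd.
   Context: $\mathbb{S}^{d-1}$ is the unit sphere in $\mathbb{R}^d$. For a configuration $X=\{x_1,\dots,x_N\}\subset\mathbb{S}^{d-1}$ of $N$ distinct points, the logarithmic energy is $$E_{\log}(X)=\sum_{1\le i\ne j\le N}\log\frac{1}{|x_i-x_j|}.$$ Local minimum means local minimum of $E_{\log}$ as a function of the $N$-tuple of distinct points $(x_1,\dots,x_N)\in(\mathbb{S}^{d-1})^N$. A regular simplex of cardinality $m$ is a set of $m$ points whose pairwise distances are all equal. Two sets of points $Y,Z\subset\mathbb{S}^{d-1}$ are orthogonal to each other if $y\cdot z=0$ for all $y\in Y$, $z\in Z$. *)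

theory Defs
  imports "HOL-Analysis.Analysis"
begin

text \<open>
  Configurations are labelled: a vector of points indexed by a finite type \<open>'n\<close>, with the product
  topology of \<open>(real ^ 'd) ^ 'n\<close>.
\<close>

definition configurations :: "((real ^ 'd) ^ 'n) set" where
  "configurations = {x. inj (($) x) \<and> range (($) x) \<subseteq> sphere 0 1}"

text \<open>The sum runs over ordered pairs, so every unordered pair is counted twice.\<close>

definition log_energy :: "(real ^ 'd) ^ 'n \<Rightarrow> real" where
  "log_energy x = (\<Sum>(i, j) \<in> {(i, j). i \<noteq> j}. ln (1 / dist (x $ i) (x $ j)))"

definition log_local_minimum :: "(real ^ 'd) ^ 'n \<Rightarrow> bool" where
  "log_local_minimum x \<longleftrightarrow>
     x \<in> configurations \<and>
     (\<forall>\<^sub>F y in at x within configurations. log_energy x \<le> log_energy y)"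

definition log_global_minimum :: "(real ^ 'd) ^ 'n \<Rightarrow> bool" where
  "log_global_minimum x \<longleftrightarrow> is_arg_min log_energy (\<lambda>y. y \<in> configurations) x"

definition regular_simplex :: "nat \<Rightarrow> 'a::metric_space set \<Rightarrow> bool" where
  "regular_simplex m Y \<longleftrightarrow>
     finite Y \<and> card Y = m \<and> (\<exists>r. \<forall>y\<in>Y. \<forall>z\<in>Y. y \<noteq> z \<longrightarrow> dist y z = r)"

definition two_orthogonal_simplexes :: "nat \<Rightarrow> nat \<Rightarrow> (real ^ 'd) set \<Rightarrow> bool" where
  "two_orthogonal_simplexes m n X \<longleftrightarrow>
     (\<exists>Y Z. X = Y \<union> Z \<and> Y \<subseteq> sphere 0 1 \<and> Z \<subseteq> sphere 0 1 \<and>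
        regular_simplex m Y \<and> regular_simplex n Z \<and>
        (\<forall>y\<in>Y. \<forall>z\<in>Z. orthogonal y z))"

end

theory Submission
  imports Defs
begin

text \<open>
  The structure of a local minimum is read off from the first and the second variation of the energy
  when the points move along great circles. Let \<open>N = d + 2\<close>, \<open>\<alpha> = 1 - 1 / N\<close>, let \<open>g i j\<close> be the Gram
  matrix of the points \<open>x i\<close>, and let \<open>a i j = 1 / (1 - g i j)\<close>.

  The first variation says that \<open>\<Sum>j\<noteq>i. a i j *\<^sub>R x j\<close> is a multiple of \<open>x i\<close>, and this forces the
  centroid to be \<open>0\<close>. Equivalently, the symmetric matrix \<open>B\<close> (called \<open>stress\<close> below) that has
  \<open>\<alpha> - a i j\<close> off the diagonal and zero row sums satisfies \<open>\<Sum>j. B i j *\<^sub>R x j = 0\<close>. In terms of \<open>B\<close>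
  the second variation along a tangent field \<open>h\<close> is
  \<open>\<alpha> * |\<Sum>i. h i|\<^sup>2 - (\<Sum>i j. B i j * (h i \<bullet> h j)) + 1/2 * (\<Sum>i\<noteq>j. (a i j * (h i \<bullet> x j + x i \<bullet> h j))\<^sup>2)\<close>,
  so a minimum wants \<open>B\<close> to be small. On the other hand \<open>B i i = (\<Sum>j\<noteq>i. (B i j)\<^sup>2 / a i j)\<close> is
  nonnegative.

  If the points do not span the space, moving them in a direction \<open>e\<close> orthogonal to all of them makes
  the last sum vanish and yields \<open>B i i \<le> 0\<close>, hence \<open>B = 0\<close>; then all distances agree, which is
  impossible for \<open>d + 2\<close> points (\<open>local_minimum_spans\<close>). So the points span, the linear relations
  \<open>\<Sum>i. u i *\<^sub>R x i = 0\<close> with \<open>\<Sum>i. u i = 0\<close> form a line, and \<open>B\<close>, whose rows are such relations,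
  has rank one: \<open>B i j = v i * v j\<close> (\<open>stress_rank_one\<close>).

  This turns into \<open>(\<alpha> - v i * v j) * g i j = \<delta> i j - 1 / N - v i * v j\<close>. Put \<open>\<tau> = \<Sum>i. (v i)\<^sup>2\<close> and
  \<open>s = \<Sum>i. (v i)\<^sup>2 *\<^sub>R x i\<close>. Applying the matrix identity to \<open>v\<close> gives \<open>v i * (x i \<bullet> s) = (\<tau> - 1) * v i\<close>
  and \<open>|s|\<^sup>2 = (\<tau> - 1) * \<tau>\<close>; in particular \<open>\<tau> \<ge> 1\<close>. If \<open>v k = 0\<close>, then \<open>x k\<close> has the same distance
  to all other points, and moving every point \<open>x i\<close> towards \<open>x k\<close> at a speed proportional to \<open>v i\<close>
  gives a negative second variation (\<open>stress_factor_nonzero\<close>). Hence no \<open>v i\<close> vanishes, \<open>x i \<bullet> s\<close> is the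
  constant \<open>\<tau> - 1\<close>, and summing over \<open>i\<close> gives \<open>\<tau> = 1\<close> and \<open>s = 0\<close>. But then \<open>(v i)\<^sup>2 - 1 / N\<close> is one
  more relation, so it is a multiple of \<open>v i\<close>: the numbers \<open>v i\<close> are roots of one quadratic polynomial
  with constant term \<open>- 1 / N\<close>. Two points with the two different values are orthogonal because
  \<open>a i j = \<alpha> + 1 / N = 1\<close>, and within a class all distances agree
  (\<open>local_minimum_simplex_pair\<close>).

  Conversely, counting dimensions shows that two orthogonal regular simplexes with \<open>d + 2\<close> vertices in
  all are both centred at the origin. This fixes the Gram matrix, hence the configuration up to an
  orthogonal transformation (\<open>two_orthogonal_simplexes_congruent\<close>) and its energy. For sizes \<open>m\<close> and
  \<open>n\<close> the energy is a constant minus half of \<open>\<psi> m + \<psi> n\<close>, where \<open>\<psi> t = t * (t - 1) * ln (t / (t - 1))\<close>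
  is strictly concave (\<open>simplex_gain_balancing\<close>). A global minimum exists by compactness, and by
  concavity its two sizes differ by at most one.
\<close>

section \<open>Variation of the energy along great circles\<close>

text \<open>
  If \<open>D\<close> were negative, \<open>f'\<close> would be negative just to the right of its zero \<open>0\<close>, so \<open>f\<close> would drop
  below \<open>f 0\<close> there.
\<close>

lemma second_derivative_test:
  fixes f f' :: "real \<Rightarrow> real"
  assumes min: "\<forall>\<^sub>F t in nhds 0. f 0 \<le> f t"
    and deriv: "\<forall>\<^sub>F t in nhds 0. (f has_real_derivative f' t) (at t)"
    and deriv2: "(f' has_real_derivative D) (at 0)"
  shows "f' 0 = 0" and "0 \<le> D"
proof -
  obtain e where e: "0 < e" "\<And>t. \<bar>t\<bar> < e \<Longrightarrow> f 0 \<le> f t"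
    and e': "\<And>t. \<bar>t\<bar> < e \<Longrightarrow> (f has_real_derivative f' t) (at t)"
    using eventually_conj[OF min deriv]
    by (auto simp: eventually_nhds_metric dist_real_def)
  show zero: "f' 0 = 0"
    using DERIV_local_min[OF e'[of 0] e(1)] e by auto
  show "0 \<le> D"
  proof (rule ccontr)
    assume "\<not> 0 \<le> D"
    then obtain c where c: "c > 0" "\<And>t. 0 < t \<Longrightarrow> t < c \<Longrightarrow> f' t < 0"
      using DERIV_neg_dec_right[OF deriv2] zero by auto
    define t where "t = min c e / 2"
    have t: "0 < t" "t < c" "t < e"
      using c e by (auto simp: t_def min_def)
    obtain z where z: "0 < z" "z < t" "f t - f 0 = (t - 0) * f' z"
      using MVT2[OF t(1), of f f'] e' t by force
    have "(t - 0) * f' z < 0"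
      using c(2)[of z] z t by (auto intro: mult_pos_neg)
    with z e(2)[of t] t show False by auto
  qed
qed

text \<open>
  The unit-sphere geodesic that starts at \<open>x\<close> with velocity \<open>h\<close>, when \<open>h\<close> is tangent at \<open>x\<close>. Since
  \<open>sgn 0 = 0\<close>, a point with \<open>h = 0\<close> stays where it is.
\<close>

definition great_circle :: "'a::real_inner \<Rightarrow> 'a \<Rightarrow> real \<Rightarrow> 'a" where
  "great_circle x h t = cos (norm h * t) *\<^sub>R x + sin (norm h * t) *\<^sub>R sgn h"

definition great_circle_velocity :: "'a::real_inner \<Rightarrow> 'a \<Rightarrow> real \<Rightarrow> 'a" where
  "great_circle_velocity x h t =
     norm h *\<^sub>R (cos (norm h * t) *\<^sub>R sgn h - sin (norm h * t) *\<^sub>R x)"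

lemma great_circle_0 [simp]: "great_circle x h 0 = x"
  by (simp add: great_circle_def)

lemma great_circle_velocity_0 [simp]: "great_circle_velocity x h 0 = h"
  by (cases "h = 0") (simp_all add: great_circle_velocity_def sgn_div_norm)

lemma norm_great_circle:
  assumes "norm x = 1" and "h \<bullet> x = 0"
  shows "norm (great_circle x h t) = 1"
proof -
  have "great_circle x h t \<bullet> great_circle x h t
      = (cos (norm h * t))\<^sup>2 * (x \<bullet> x) + (sin (norm h * t))\<^sup>2 * (sgn h \<bullet> sgn h)"
    using assms
    by (simp add: great_circle_def inner_add_left inner_add_right power2_eq_square sgn_div_norm
        inner_commute)
  also have "x \<bullet> x = 1"
    using assms by (simp add: dot_square_norm)
  also have "(sin (norm h * t))\<^sup>2 * (sgn h \<bullet> sgn h) = (sin (norm h * t))\<^sup>2"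
    by (cases "h = 0") (auto simp: dot_square_norm norm_sgn)
  finally show ?thesis
    by (simp add: norm_eq_1)
qed

lemma great_circle_vector_derivative:
  "(great_circle x h has_vector_derivative great_circle_velocity x h t) (at t)"
  unfolding great_circle_def great_circle_velocity_def
  by (auto intro!: derivative_eq_intros simp: algebra_simps)

lemma great_circle_velocity_vector_derivative:
  "(great_circle_velocity x h has_vector_derivative - (norm h)\<^sup>2 *\<^sub>R great_circle x h t) (at t)"
  unfolding great_circle_def great_circle_velocity_def
  by (auto intro!: derivative_eq_intros simp: algebra_simps power2_eq_square)

lemma has_real_derivative_inner:
  assumes "(f has_vector_derivative f') (at t)" and "(g has_vector_derivative g') (at t)"
  shows "((\<lambda>t. f t \<bullet> g t) has_real_derivative f' \<bullet> g t + f t \<bullet> g') (at t)"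
proof -
  have "((\<lambda>t. f t \<bullet> g t) has_vector_derivative f t \<bullet> g' + f' \<bullet> g t) (at t)"
    using bounded_bilinear.has_vector_derivative[OF bounded_bilinear_inner assms] .
  then show ?thesis
    by (simp add: has_real_derivative_iff_has_vector_derivative add.commute)
qed

lemma sum_offdiagonal:
  fixes f :: "'n::finite \<Rightarrow> 'n \<Rightarrow> 'b::comm_monoid_add"
  shows "(\<Sum>(i, j) \<in> {(i, j). i \<noteq> j}. f i j) = (\<Sum>i\<in>UNIV. \<Sum>j\<in>-{i}. f i j)"
proof -
  have "{(i, j). i \<noteq> j} = Sigma (UNIV :: 'n set) (\<lambda>i. -{i})" by auto
  then show ?thesis by (simp add: sum.Sigma)
qed

lemma configurationsD:
  assumes "x \<in> configurations"
  shows "norm (x $ i) = 1" and "x $ i \<bullet> x $ i = 1" and "i \<noteq> j \<Longrightarrow> x $ i \<noteq> x $ j"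
proof -
  show "norm (x $ i) = 1"
    using assms by (auto simp: configurations_def image_subset_iff)
  then show "x $ i \<bullet> x $ i = 1"
    by (simp add: norm_eq_1)
  show "i \<noteq> j \<Longrightarrow> x $ i \<noteq> x $ j"
    using assms by (auto simp: configurations_def inj_def)
qed

lemma configurationsI:
  assumes "\<And>i. norm (x $ i) = 1" and "\<And>i j. i \<noteq> j \<Longrightarrow> x $ i \<noteq> x $ j"
  shows "x \<in> configurations"
  using assms by (auto simp: configurations_def inj_def)

lemma dist_unit_vectors:
  assumes "norm x = 1" and "norm y = 1"
  shows "(dist x y)\<^sup>2 = 2 - 2 * (x \<bullet> y)"
proof -
  have "x \<bullet> x = 1" "y \<bullet> y = 1"
    using assms by (simp_all add: norm_eq_1)
  then show ?thesis
    by (simp add: dist_norm power2_norm_eq_inner inner_diff_left inner_diff_right inner_commute)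
qed

lemma inner_less_1:
  assumes "norm x = 1" and "norm y = 1" and "x \<noteq> y"
  shows "x \<bullet> y < 1"
proof -
  have "0 < (dist x y)\<^sup>2" using assms by simp
  then show ?thesis using dist_unit_vectors[OF assms(1,2)] by simp
qed

lemma log_energy_eq_inner:
  fixes x :: "(real ^ 'd) ^ 'n"
  assumes "x \<in> configurations"
  shows "log_energy x = (\<Sum>i\<in>UNIV. \<Sum>j\<in>-{i}. - (1/2) * ln (2 - 2 * (x $ i \<bullet> x $ j)))"
  unfolding log_energy_def sum_offdiagonal
proof (intro sum.cong refl)
  fix i j :: 'n assume "j \<in> - {i}"
  then have "0 < dist (x $ i) (x $ j)"
    using configurationsD(3)[OF assms] by force
  then have "ln (2 - 2 * (x $ i \<bullet> x $ j)) = 2 * ln (dist (x $ i) (x $ j))"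
    using dist_unit_vectors[of "x $ i" "x $ j"] configurationsD(1)[OF assms]
    by (metis ln_realpow of_nat_numeral)
  then show "ln (1 / dist (x $ i) (x $ j)) = - (1/2) * ln (2 - 2 * (x $ i \<bullet> x $ j))"
    using \<open>0 < dist (x $ i) (x $ j)\<close> by (simp add: ln_div)
qed

text \<open>
  On unit vectors the energy of an ordered pair is \<open>- ln (2 - 2 * g) / 2\<close> with \<open>g = x $ i \<bullet> x $ j\<close>, and
  its derivatives in \<open>g\<close> are \<open>a / 2\<close> and \<open>a\<^sup>2 / 2\<close> for the weight \<open>a = 1 / (1 - g)\<close>.
\<close>

definition weight :: "(real ^ 'd) ^ 'n \<Rightarrow> 'n \<Rightarrow> 'n \<Rightarrow> real" where
  "weight x i j = 1 / (1 - x $ i \<bullet> x $ j)"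

text \<open>
  The inner product \<open>g\<close> of two points that move along great circles has first derivative \<open>b i j\<close> at time
  \<open>0\<close>, and, since the acceleration of a great circle is \<open>- |h|\<^sup>2\<close> times its position, second derivative
  \<open>2 * (h i \<bullet> h j) - g * (|h i|\<^sup>2 + |h j|\<^sup>2)\<close>. The two claims are that the first derivative of the energy
  along this motion is zero and that the second one is nonnegative.
\<close>

proposition local_minimum_variations:
  fixes x :: "(real ^ 'd) ^ 'n" and h :: "'n \<Rightarrow> real ^ 'd"
  assumes min: "log_local_minimum x" and tangent: "\<And>i. h i \<bullet> x $ i = 0"
  defines "b \<equiv> \<lambda>i j. h i \<bullet> x $ j + x $ i \<bullet> h j"
  shows "(\<Sum>i\<in>UNIV. \<Sum>j\<in>-{i}. weight x i j * b i j) = 0"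
    and "0 \<le> (\<Sum>i\<in>UNIV. \<Sum>j\<in>-{i}.
           weight x i j * (2 * (h i \<bullet> h j) - (x $ i \<bullet> x $ j) * ((norm (h i))\<^sup>2 + (norm (h j))\<^sup>2))
           + (weight x i j * b i j)\<^sup>2)"
proof -
  have conf: "x \<in> configurations"
    using min by (simp add: log_local_minimum_def)
  define y where "y = (\<lambda>i. great_circle (x $ i) (h i))"
  define z where "z = (\<lambda>i. great_circle_velocity (x $ i) (h i))"
  define curve where "curve = (\<lambda>t. \<chi> i. y i t)"
  define g where "g = (\<lambda>i j t. y i t \<bullet> y j t)"
  define g' where "g' = (\<lambda>i j t. z i t \<bullet> y j t + y i t \<bullet> z j t)"
  define f where "f = (\<lambda>t. \<Sum>i\<in>UNIV. \<Sum>j\<in>-{i}. - (1/2) * ln (2 - 2 * g i j t))"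
  define f' where "f' = (\<lambda>t. \<Sum>i\<in>UNIV. \<Sum>j\<in>-{i}. 1/2 * (g' i j t / (1 - g i j t)))"
  have y0: "y i 0 = x $ i" and z0: "z i 0 = h i" for i
    by (simp_all add: y_def z_def)
  have normy: "norm (y i t) = 1" for i t
    unfolding y_def using norm_great_circle configurationsD(1)[OF conf] tangent by blast
  have dy: "(y i has_vector_derivative z i t) (at t)" for i t
    unfolding y_def z_def by (rule great_circle_vector_derivative)
  have dz: "(z i has_vector_derivative - (norm (h i))\<^sup>2 *\<^sub>R y i t) (at t)" for i t
    unfolding y_def z_def by (rule great_circle_velocity_vector_derivative)
  have dg: "(g i j has_real_derivative g' i j t) (at t)" for i j t
    unfolding g_def g'_def by (rule has_real_derivative_inner[OF dy dy])
  define g'' where "g'' = (\<lambda>i j. 2 * (h i \<bullet> h j)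
      - (x $ i \<bullet> x $ j) * ((norm (h i))\<^sup>2 + (norm (h j))\<^sup>2))"
  have dg': "(g' i j has_real_derivative g'' i j) (at 0)" for i j
    unfolding g'_def
    by (rule DERIV_cong[OF DERIV_add[OF has_real_derivative_inner[OF dz dy]
            has_real_derivative_inner[OF dy dz]]])
      (simp add: y0 z0 g''_def algebra_simps)
  have g_lt: "g i j 0 < 1" if "i \<noteq> j" for i j
    using inner_less_1[OF normy normy, of i 0 j 0] configurationsD(3)[OF conf that]
    by (simp add: g_def y0)
  have "\<forall>\<^sub>F t in nhds 0. i \<noteq> j \<longrightarrow> g i j t < 1" for i j
  proof (cases "i = j")
    case False
    have "isCont (g i j) 0" using dg DERIV_isCont by blast
    then have "(g i j \<longlongrightarrow> g i j 0) (nhds 0)"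
      by (simp add: isCont_def tendsto_nhds_iff)
    then have "\<forall>\<^sub>F t in nhds 0. g i j t < 1"
      using g_lt[OF False] order_tendstoD(2) by blast
    then show ?thesis by eventually_elim simp
  qed simp
  then have "\<forall>\<^sub>F t in nhds 0. \<forall>i j. i \<noteq> j \<longrightarrow> g i j t < 1"
    by (intro eventually_all_finite)
  moreover have "y i t \<noteq> y j t" if "g i j t < 1" for i j t
    using that normy[of i t] by (auto simp: g_def norm_eq_1)
  ultimately have near: "\<forall>\<^sub>F t in nhds 0. curve t \<in> configurations \<and> (\<forall>i j. i \<noteq> j \<longrightarrow> g i j t < 1)"
    by (elim eventually_mono) (auto intro!: configurationsI simp: curve_def normy)
  have f_eq: "f t = log_energy (curve t)" if "curve t \<in> configurations" for t
    using log_energy_eq_inner[OF that] by (simp add: f_def g_def curve_def)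
  have curve0: "curve 0 = x"
    by (simp add: curve_def y0 vec_eq_iff)
  have "(curve \<longlongrightarrow> x) (nhds 0)"
  proof -
    have "isCont (y i) 0" for i
      using dy has_vector_derivative_continuous by blast
    then have "(y i \<longlongrightarrow> x $ i) (nhds 0)" for i
      by (simp add: isCont_def tendsto_nhds_iff y0)
    then show ?thesis
      by (auto intro: vec_tendstoI simp: curve_def)
  qed
  moreover have "\<forall>\<^sub>F w in nhds x. w \<in> configurations \<longrightarrow> log_energy x \<le> log_energy w"
    using min unfolding log_local_minimum_def eventually_at_filter
    by (auto elim: eventually_mono)
  ultimately have "\<forall>\<^sub>F t in nhds 0. curve t \<in> configurations \<longrightarrow> log_energy x \<le> log_energy (curve t)"
    unfolding filterlim_iff by blast
  with near have f_min: "\<forall>\<^sub>F t in nhds 0. f 0 \<le> f t"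
    by eventually_elim (auto simp: f_eq curve0 conf)
  have f_deriv: "\<forall>\<^sub>F t in nhds 0. (f has_real_derivative f' t) (at t)"
    using near
  proof eventually_elim
    case (elim t)
    show ?case
      unfolding f_def f'_def
    proof (intro DERIV_sum)
      fix i j :: 'n assume "j \<in> - {i}"
      then have "g i j t < 1" using elim by auto
      then show "((\<lambda>t. - (1/2) * ln (2 - 2 * g i j t)) has_real_derivative
          1/2 * (g' i j t / (1 - g i j t))) (at t)"
        by (auto intro!: derivative_eq_intros dg simp: field_simps)
    qed
  qed
  define D where "D = (\<Sum>i\<in>UNIV. \<Sum>j\<in>-{i}. 1/2 * (weight x i j * g'' i j + (weight x i j * b i j)\<^sup>2))"
  have f_deriv2: "(f' has_real_derivative D) (at 0)"
    unfolding f'_def D_def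
  proof (intro DERIV_sum)
    fix i j :: 'n assume "j \<in> - {i}"
    then have lt: "g i j 0 < 1" using g_lt by auto
    have g0: "g i j 0 = x $ i \<bullet> x $ j" and g'0: "g' i j 0 = b i j"
      by (simp_all add: g_def g'_def b_def y0 z0)
    have "((\<lambda>t. 1/2 * (g' i j t / (1 - g i j t))) has_real_derivative
        1/2 * ((g'' i j * (1 - g i j 0) + g' i j 0 * g' i j 0) / ((1 - g i j 0) * (1 - g i j 0)))) (at 0)"
      by (rule DERIV_cong[OF DERIV_cmult[OF DERIV_divide[OF dg' DERIV_diff[OF DERIV_const dg]]]])
        (use lt in simp_all)
    also have "(g'' i j * (1 - g i j 0) + g' i j 0 * g' i j 0) / ((1 - g i j 0) * (1 - g i j 0))
        = weight x i j * g'' i j + (weight x i j * b i j)\<^sup>2"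
      using lt unfolding g0 g'0 weight_def by (simp add: power2_eq_square add_divide_distrib)
    finally show "((\<lambda>t. 1/2 * (g' i j t / (1 - g i j t))) has_real_derivative
        1/2 * (weight x i j * g'' i j + (weight x i j * b i j)\<^sup>2)) (at 0)" .
  qed
  have "f' 0 = 1/2 * (\<Sum>i\<in>UNIV. \<Sum>j\<in>-{i}. weight x i j * b i j)"
    by (simp add: f'_def g_def g'_def b_def weight_def y0 z0 sum_distrib_left)
  then show "(\<Sum>i\<in>UNIV. \<Sum>j\<in>-{i}. weight x i j * b i j) = 0"
    using second_derivative_test(1)[OF f_min f_deriv f_deriv2] by simp
  have "D = 1/2 * (\<Sum>i\<in>UNIV. \<Sum>j\<in>-{i}. weight x i j * g'' i j + (weight x i j * b i j)\<^sup>2)"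
    by (simp add: D_def sum_distrib_left)
  then show "0 \<le> (\<Sum>i\<in>UNIV. \<Sum>j\<in>-{i}.
           weight x i j * (2 * (h i \<bullet> h j) - (x $ i \<bullet> x $ j) * ((norm (h i))\<^sup>2 + (norm (h j))\<^sup>2))
           + (weight x i j * b i j)\<^sup>2)"
    using second_derivative_test(2)[OF f_min f_deriv f_deriv2] by (simp add: g''_def)
qed

section \<open>The equilibrium stress of a local minimum\<close>

lemma sum_offdiagonal_swap:
  fixes f :: "'n::finite \<Rightarrow> 'n \<Rightarrow> 'b::comm_monoid_add"
  shows "(\<Sum>i\<in>UNIV. \<Sum>j\<in>-{i}. f i j) = (\<Sum>i\<in>UNIV. \<Sum>j\<in>-{i}. f j i)"
  unfolding sum_offdiagonal[symmetric]
  by (rule sum.reindex_bij_witness[of _ prod.swap prod.swap]) auto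

lemma sum_except:
  fixes f :: "'n::finite \<Rightarrow> 'b::ab_group_add"
  shows "(\<Sum>j\<in>-{i}. f j) = sum f UNIV - f i"
  by (simp add: Compl_eq_Diff_UNIV sum_diff)

lemma card_except: "real (card (- {i :: 'n::finite})) = real CARD('n) - 1"
  by (simp add: Compl_eq_Diff_UNIV card_Diff_singleton of_nat_diff Suc_leI)

lemma weight_sym: "weight x i j = weight x j i"
  by (simp add: weight_def inner_commute)

lemma weight_pos:
  assumes "x \<in> configurations" and "i \<noteq> j"
  shows "0 < weight x i j"
  using inner_less_1[of "x $ i" "x $ j"] configurationsD[OF assms(1)] assms(2)
  by (simp add: weight_def)

lemma weight_inner:
  assumes "x \<in> configurations" and "i \<noteq> j"
  shows "weight x i j * (x $ i \<bullet> x $ j) = weight x i j - 1"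
  using inner_less_1[of "x $ i" "x $ j"] configurationsD[OF assms(1)] assms(2)
  by (simp add: weight_def field_simps)

text \<open>
  The left-hand side is the gradient in the \<open>i\<close>-th point of the energy, written in terms of inner
  products. At a local minimum it has no component tangential to the sphere.
\<close>

lemma local_minimum_balance:
  fixes x :: "(real ^ 'd) ^ 'n"
  assumes min: "log_local_minimum x"
  shows "(\<Sum>j\<in>-{i}. weight x i j *\<^sub>R x $ j) = (\<Sum>j\<in>-{i}. weight x i j * (x $ i \<bullet> x $ j)) *\<^sub>R x $ i"
proof -
  have conf: "x \<in> configurations"
    using min by (simp add: log_local_minimum_def)
  define F where "F = (\<lambda>i. \<Sum>j\<in>-{i}. weight x i j *\<^sub>R x $ j)"
  \<comment> \<open>Moving every point along the tangential part of its own gradient changes the energy at the rate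
    given by the sum of the squared lengths of these parts.\<close>
  define h where "h = (\<lambda>i. F i - (F i \<bullet> x $ i) *\<^sub>R x $ i)"
  have tangent: "h i \<bullet> x $ i = 0" for i
    by (simp add: h_def inner_diff_left configurationsD[OF conf])
  have "h i \<bullet> F i = h i \<bullet> h i" for i
    using tangent[of i] by (simp add: h_def inner_diff_right)
  have "0 = (\<Sum>i\<in>UNIV. \<Sum>j\<in>-{i}. weight x i j * (h i \<bullet> x $ j + x $ i \<bullet> h j))"
    using local_minimum_variations(1)[OF min, of h] tangent by simp
  also have "\<dots> = (\<Sum>i\<in>UNIV. \<Sum>j\<in>-{i}. weight x i j * (h i \<bullet> x $ j))
      + (\<Sum>i\<in>UNIV. \<Sum>j\<in>-{i}. weight x i j * (x $ i \<bullet> h j))"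
    by (simp add: distrib_left sum.distrib)
  also have "(\<Sum>i\<in>UNIV. \<Sum>j\<in>-{i}. weight x i j * (x $ i \<bullet> h j))
      = (\<Sum>i\<in>UNIV. \<Sum>j\<in>-{i}. weight x i j * (h i \<bullet> x $ j))"
    by (subst sum_offdiagonal_swap) (simp add: weight_sym inner_commute)
  also have "(\<Sum>i\<in>UNIV. \<Sum>j\<in>-{i}. weight x i j * (h i \<bullet> x $ j)) = (\<Sum>i\<in>UNIV. h i \<bullet> F i)"
    by (simp add: F_def inner_sum_right)
  also have "\<dots> = (\<Sum>i\<in>UNIV. h i \<bullet> h i)"
    using \<open>\<And>i. h i \<bullet> F i = h i \<bullet> h i\<close> by simp
  finally have "(\<Sum>i\<in>UNIV. h i \<bullet> h i) = 0" by simp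
  then have "h i = 0"
    by (subst (asm) sum_nonneg_eq_0_iff) auto
  then have "F i = (F i \<bullet> x $ i) *\<^sub>R x $ i"
    by (simp add: h_def)
  also have "F i \<bullet> x $ i = (\<Sum>j\<in>-{i}. weight x i j * (x $ i \<bullet> x $ j))"
    by (subst inner_commute) (simp add: F_def inner_sum_right)
  finally show ?thesis by (simp add: F_def)
qed

text \<open>
  The weighted Laplacian of the complete graph with weights \<open>a i j\<close>, minus \<open>N - 1\<close> times the identity,
  plus \<open>\<alpha> = 1 - 1 / N\<close> times the all-ones matrix. At a local minimum the Laplacian has the coordinate
  functions of the configuration as eigenvectors for \<open>N - 1\<close>; the all-ones matrix is added to put the
  constant functions into the kernel as well. A symmetric matrix with these two properties is an
  equilibrium stress in the sense of rigidity theory.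
\<close>

definition stress :: "(real ^ 'd) ^ 'n \<Rightarrow> 'n \<Rightarrow> 'n \<Rightarrow> real" where
  "stress x i j = 1 - 1 / CARD('n)
     + (if i = j then \<Sum>k\<in>-{i}. weight x i k * (x $ i \<bullet> x $ k) else - weight x i j)"

lemma stress_sym: "stress x i j = stress x j i"
  by (auto simp: stress_def weight_sym)

lemma stress_diagonal_weights:
  fixes x :: "(real ^ 'd) ^ 'n"
  assumes "x \<in> configurations"
  shows "(\<Sum>k\<in>-{i}. weight x i k * (x $ i \<bullet> x $ k))
       = (\<Sum>k\<in>-{i}. weight x i k) - (real CARD('n) - 1)"
proof -
  have "(\<Sum>k\<in>-{i}. weight x i k * (x $ i \<bullet> x $ k)) = (\<Sum>k\<in>-{i}. weight x i k - 1)"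
    using weight_inner[OF assms] by (intro sum.cong) auto
  also have "\<dots> = (\<Sum>k\<in>-{i}. weight x i k) - real (card (-{i}))"
    by (simp add: sum_subtractf)
  finally show ?thesis
    by (simp add: card_except)
qed

lemma stress_row_sum:
  fixes x :: "(real ^ 'd) ^ 'n"
  assumes "x \<in> configurations"
  shows "(\<Sum>j\<in>UNIV. stress x i j) = 0"
proof -
  have "(\<Sum>j\<in>UNIV. stress x i j) = stress x i i + (\<Sum>j\<in>-{i}. stress x i j)"
    by (simp add: sum_except)
  also have "(\<Sum>j\<in>-{i}. stress x i j) = (\<Sum>j\<in>-{i}. (1 - 1 / CARD('n)) - weight x i j)"
    by (intro sum.cong) (auto simp: stress_def)
  also have "\<dots> = (real CARD('n) - 1) * (1 - 1 / CARD('n)) - (\<Sum>j\<in>-{i}. weight x i j)"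
    by (simp add: sum_subtractf card_except)
  finally show ?thesis
    using stress_diagonal_weights[OF assms, of i] by (simp add: stress_def field_simps)
qed

text \<open>
  Summing the balance conditions over all \<open>i\<close> cancels the weights, because they are symmetric, and
  leaves a nonzero multiple of the centroid.
\<close>

lemma local_minimum_centroid:
  fixes x :: "(real ^ 'd) ^ 'n"
  assumes min: "log_local_minimum x" and card: "1 < CARD('n)"
  shows "(\<Sum>i\<in>UNIV. x $ i) = 0"
proof -
  have conf: "x \<in> configurations"
    using min by (simp add: log_local_minimum_def)
  define W where "W = (\<lambda>i. \<Sum>k\<in>-{i}. weight x i k)"
  have "(\<Sum>i\<in>UNIV. W i *\<^sub>R x $ i) = (\<Sum>i\<in>UNIV. \<Sum>j\<in>-{i}. weight x i j *\<^sub>R x $ i)"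
    by (simp add: W_def scaleR_left.sum)
  also have "\<dots> = (\<Sum>i\<in>UNIV. \<Sum>j\<in>-{i}. weight x i j *\<^sub>R x $ j)"
    by (subst sum_offdiagonal_swap) (simp add: weight_sym)
  also have "\<dots> = (\<Sum>i\<in>UNIV. (W i - (real CARD('n) - 1)) *\<^sub>R x $ i)"
    using local_minimum_balance[OF min] stress_diagonal_weights[OF conf] by (simp add: W_def)
  also have "\<dots> = (\<Sum>i\<in>UNIV. W i *\<^sub>R x $ i) - (real CARD('n) - 1) *\<^sub>R (\<Sum>i\<in>UNIV. x $ i)"
    by (simp add: scaleR_left_diff_distrib sum_subtractf scaleR_right.sum)
  finally show ?thesis
    using card by simp
qed

text \<open>
  This is the balance condition; the all-ones part contributes a multiple of the centroid, which is \<open>0\<close>.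
\<close>

lemma stress_equilibrium:
  fixes x :: "(real ^ 'd) ^ 'n"
  assumes min: "log_local_minimum x" and card: "1 < CARD('n)"
  shows "(\<Sum>j\<in>UNIV. stress x i j *\<^sub>R x $ j) = 0"
proof -
  define \<alpha> where "\<alpha> = 1 - 1 / real CARD('n)"
  have "(\<Sum>j\<in>UNIV. stress x i j *\<^sub>R x $ j)
      = stress x i i *\<^sub>R x $ i + (\<Sum>j\<in>-{i}. stress x i j *\<^sub>R x $ j)"
    by (simp add: sum_except)
  also have "(\<Sum>j\<in>-{i}. stress x i j *\<^sub>R x $ j)
      = (\<Sum>j\<in>-{i}. \<alpha> *\<^sub>R x $ j - weight x i j *\<^sub>R x $ j)"
    by (intro sum.cong) (auto simp: stress_def \<alpha>_def algebra_simps)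
  also have "\<dots> = \<alpha> *\<^sub>R (\<Sum>j\<in>-{i}. x $ j) - (\<Sum>j\<in>-{i}. weight x i j *\<^sub>R x $ j)"
    by (simp add: sum_subtractf scaleR_right.sum)
  also have "(\<Sum>j\<in>-{i}. x $ j) = - x $ i"
    using local_minimum_centroid[OF assms] by (simp add: sum_except)
  finally show ?thesis
    unfolding local_minimum_balance[OF min] by (simp add: stress_def \<alpha>_def scaleR_left_distrib)
qed

text \<open>
  As the centroid is \<open>0\<close>, the numbers \<open>1 / a i j = 1 - g i j\<close> with \<open>j \<noteq> i\<close> sum to \<open>N\<close>. Expanding
  \<open>(a i j - \<alpha>)\<^sup>2 / a i j\<close> therefore gives back the row sum of the weights up to a constant. This is the
  equality form of the estimate between the arithmetic and the harmonic mean of the weights of a row.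
\<close>

lemma stress_diagonal:
  fixes x :: "(real ^ 'd) ^ 'n"
  assumes min: "log_local_minimum x" and card: "1 < CARD('n)"
  shows "stress x i i = (\<Sum>j\<in>-{i}. (stress x i j)\<^sup>2 / weight x i j)"
proof -
  have conf: "x \<in> configurations"
    using min by (simp add: log_local_minimum_def)
  define \<alpha> where "\<alpha> = 1 - 1 / real CARD('n)"
  define d where "d = (\<lambda>j. 1 - x $ i \<bullet> x $ j)"
  have "(\<Sum>j\<in>-{i}. (stress x i j)\<^sup>2 / weight x i j)
      = (\<Sum>j\<in>-{i}. weight x i j - 2 * \<alpha> + \<alpha>\<^sup>2 * d j)"
  proof (intro sum.cong refl)
    fix j assume "j \<in> - {i}"
    then have "0 < weight x i j" "d j = 1 / weight x i j" "stress x i j = \<alpha> - weight x i j"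
      using weight_pos[OF conf] by (auto simp: stress_def \<alpha>_def weight_def d_def)
    then show "(stress x i j)\<^sup>2 / weight x i j = weight x i j - 2 * \<alpha> + \<alpha>\<^sup>2 * d j"
      unfolding \<open>d j = 1 / weight x i j\<close> \<open>stress x i j = \<alpha> - weight x i j\<close>
      by (simp add: power2_eq_square field_simps)
  qed
  also have "\<dots> = (\<Sum>j\<in>-{i}. weight x i j) - 2 * \<alpha> * (real CARD('n) - 1)
      + \<alpha>\<^sup>2 * (\<Sum>j\<in>-{i}. d j)"
    by (simp add: sum.distrib sum_subtractf sum_distrib_left card_except)
  also have "(\<Sum>j\<in>-{i}. d j) = real CARD('n) - 1 - (x $ i \<bullet> (\<Sum>j\<in>UNIV. x $ j) - 1)"
    by (simp add: d_def sum_subtractf inner_sum_right sum_except card_except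
        configurationsD[OF conf])
  also have "\<dots> = real CARD('n)"
    by (simp add: local_minimum_centroid[OF assms])
  finally have sum_eq: "(\<Sum>j\<in>-{i}. (stress x i j)\<^sup>2 / weight x i j)
      = (\<Sum>j\<in>-{i}. weight x i j) - 2 * \<alpha> * (real CARD('n) - 1) + \<alpha>\<^sup>2 * real CARD('n)" .
  have "\<alpha> * real CARD('n) = real CARD('n) - 1"
    by (simp add: \<alpha>_def field_simps)
  then have "\<alpha>\<^sup>2 * real CARD('n) = \<alpha> * (real CARD('n) - 1)"
      and "\<alpha> * (real CARD('n) - 1) = real CARD('n) - 1 - \<alpha>"
    by (simp add: power2_eq_square mult.assoc, simp add: right_diff_distrib)
  moreover have "stress x i i = \<alpha> + ((\<Sum>j\<in>-{i}. weight x i j) - (real CARD('n) - 1))"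
    using stress_diagonal_weights[OF conf, of i] by (simp add: stress_def \<alpha>_def)
  ultimately show ?thesis
    using sum_eq by (simp only: mult.assoc) simp
qed

lemma stress_eq_0:
  fixes x :: "(real ^ 'd) ^ 'n"
  assumes min: "log_local_minimum x" and card: "1 < CARD('n)" and diag: "stress x i i \<le> 0"
  shows "stress x i j = 0"
proof -
  have conf: "x \<in> configurations"
    using min by (simp add: log_local_minimum_def)
  have nonneg: "0 \<le> (stress x i k)\<^sup>2 / weight x i k" if "k \<in> -{i}" for k
    using weight_pos[OF conf] that by (intro divide_nonneg_pos) auto
  then have zero: "(\<Sum>k\<in>-{i}. (stress x i k)\<^sup>2 / weight x i k) = 0"
    using diag stress_diagonal[OF min card, of i] by (intro antisym sum_nonneg) auto
  show ?thesis
  proof (cases "j = i")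
    case True
    then show ?thesis using zero stress_diagonal[OF min card, of i] by simp
  next
    case False
    then have "(stress x i j)\<^sup>2 / weight x i j = 0"
      using zero nonneg by (subst (asm) sum_nonneg_eq_0_iff) auto
    then show ?thesis
      using weight_pos[OF conf, of i j] False by simp
  qed
qed

text \<open>
  The nonnegative second variation, with the part of order \<open>h i \<bullet> h j\<close> rewritten through the stress.
\<close>

lemma stress_second_variation:
  fixes x :: "(real ^ 'd) ^ 'n" and h :: "'n \<Rightarrow> real ^ 'd"
  assumes min: "log_local_minimum x" and tangent: "\<And>i. h i \<bullet> x $ i = 0"
  shows "(\<Sum>i\<in>UNIV. \<Sum>j\<in>UNIV. stress x i j * (h i \<bullet> h j))
       \<le> (1 - 1 / CARD('n)) * (norm (\<Sum>i\<in>UNIV. h i))\<^sup>2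
         + 1/2 * (\<Sum>i\<in>UNIV. \<Sum>j\<in>-{i}. (weight x i j * (h i \<bullet> x $ j + x $ i \<bullet> h j))\<^sup>2)"
proof -
  define \<alpha> where "\<alpha> = 1 - 1 / real CARD('n)"
  define l where "l = (\<lambda>i. \<Sum>k\<in>-{i}. weight x i k * (x $ i \<bullet> x $ k))"
  define P where "P = (\<Sum>i\<in>UNIV. \<Sum>j\<in>-{i}. weight x i j * (h i \<bullet> h j))"
  define R where "R = (\<Sum>i\<in>UNIV. l i * (norm (h i))\<^sup>2)"
  define S where "S = (\<Sum>i\<in>UNIV. \<Sum>j\<in>-{i}. (weight x i j * (h i \<bullet> x $ j + x $ i \<bullet> h j))\<^sup>2)"
  have R1: "(\<Sum>i\<in>UNIV. \<Sum>j\<in>-{i}. weight x i j * (x $ i \<bullet> x $ j) * (norm (h i))\<^sup>2) = R"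
    by (simp add: R_def l_def sum_distrib_right)
  have R2: "(\<Sum>i\<in>UNIV. \<Sum>j\<in>-{i}. weight x i j * (x $ i \<bullet> x $ j) * (norm (h j))\<^sup>2) = R"
    unfolding R1[symmetric] by (subst sum_offdiagonal_swap) (simp add: weight_sym inner_commute)
  have "0 \<le> (\<Sum>i\<in>UNIV. \<Sum>j\<in>-{i}.
           weight x i j * (2 * (h i \<bullet> h j) - (x $ i \<bullet> x $ j) * ((norm (h i))\<^sup>2 + (norm (h j))\<^sup>2))
           + (weight x i j * (h i \<bullet> x $ j + x $ i \<bullet> h j))\<^sup>2)"
    using local_minimum_variations(2)[OF min, of h] tangent by simp
  also have "\<dots> = (\<Sum>i\<in>UNIV. \<Sum>j\<in>-{i}. 2 * (weight x i j * (h i \<bullet> h j))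
        - weight x i j * (x $ i \<bullet> x $ j) * (norm (h i))\<^sup>2
        - weight x i j * (x $ i \<bullet> x $ j) * (norm (h j))\<^sup>2
        + (weight x i j * (h i \<bullet> x $ j + x $ i \<bullet> h j))\<^sup>2)"
    by (intro sum.cong refl) (simp add: algebra_simps)
  also have "\<dots> = 2 * P - R - R + S"
    unfolding sum.distrib sum_subtractf R1 R2 sum_distrib_left[symmetric]
    by (simp add: P_def S_def)
  finally have nonneg: "0 \<le> 2 * P - R - R + S" .
  have row: "(\<Sum>j\<in>UNIV. stress x i j * (h i \<bullet> h j))
      = (\<Sum>j\<in>UNIV. \<alpha> * (h i \<bullet> h j)) + l i * (norm (h i))\<^sup>2 - (\<Sum>j\<in>-{i}. weight x i j * (h i \<bullet> h j))" for i
  proof -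
    have "(\<Sum>j\<in>UNIV. stress x i j * (h i \<bullet> h j))
        = stress x i i * (h i \<bullet> h i) + (\<Sum>j\<in>-{i}. stress x i j * (h i \<bullet> h j))"
      by (simp add: sum_except)
    also have "(\<Sum>j\<in>-{i}. stress x i j * (h i \<bullet> h j))
        = (\<Sum>j\<in>-{i}. \<alpha> * (h i \<bullet> h j) - weight x i j * (h i \<bullet> h j))"
      by (intro sum.cong) (auto simp: stress_def \<alpha>_def algebra_simps)
    also have "\<dots> = (\<Sum>j\<in>UNIV. \<alpha> * (h i \<bullet> h j)) - \<alpha> * (h i \<bullet> h i) - (\<Sum>j\<in>-{i}. weight x i j * (h i \<bullet> h j))"
      by (simp add: sum_subtractf sum_except)
    finally show ?thesis
      by (simp add: stress_def \<alpha>_def l_def power2_norm_eq_inner distrib_right)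
  qed
  have "(\<Sum>i\<in>UNIV. \<Sum>j\<in>UNIV. stress x i j * (h i \<bullet> h j))
      = (\<Sum>i\<in>UNIV. \<Sum>j\<in>UNIV. \<alpha> * (h i \<bullet> h j)) + R - P"
    unfolding row by (simp add: sum.distrib sum_subtractf R_def P_def)
  also have "(\<Sum>i\<in>UNIV. \<Sum>j\<in>UNIV. \<alpha> * (h i \<bullet> h j)) = \<alpha> * (norm (\<Sum>i\<in>UNIV. h i))\<^sup>2"
    by (subst sum.swap)
      (simp add: power2_norm_eq_inner inner_sum_left inner_sum_right sum_distrib_left)
  finally show ?thesis
    using nonneg by (simp add: \<alpha>_def S_def)
qed

section \<open>The stress of a local minimum has rank one\<close>

lemma linear_has_kernel:
  fixes f :: "'a::euclidean_space \<Rightarrow> 'b::euclidean_space"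
  assumes "linear f" and "DIM('b) < DIM('a)"
  obtains u where "u \<noteq> 0" and "f u = 0"
proof -
  have "\<not> inj f"
  proof
    assume "inj f"
    then have "dim (range f) = DIM('a)"
      using dim_image_eq[OF assms(1), of UNIV] by (simp add: inj_on_subset)
    then show False
      using dim_subset_UNIV[of "range f"] assms(2) by simp
  qed
  then show ?thesis
    using linear_injective_0[OF assms(1)] that by blast
qed

text \<open>
  There are more unknown coefficients than equations.
\<close>

lemma relation_vanishing_at:
  fixes x :: "'n::finite \<Rightarrow> 'a::euclidean_space"
  assumes "DIM('a) + 1 < CARD('n)"
  obtains u where "u \<noteq> (\<lambda>i. 0)" and "u k = 0" and "(\<Sum>i\<in>UNIV. u i *\<^sub>R x i) = 0"
proof -
  define f :: "real ^ 'n \<Rightarrow> 'a \<times> real" where "f = (\<lambda>u. (\<Sum>i\<in>UNIV. (u $ i) *\<^sub>R x i, u $ k))"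
  have "linear f"
    unfolding f_def
    by (rule linearI) (simp_all add: scaleR_left_distrib sum.distrib scaleR_right.sum)
  then obtain u where u: "u \<noteq> 0" "f u = 0"
    using linear_has_kernel[of f] assms by auto
  show ?thesis
  proof (rule that)
    show "(\<lambda>i. u $ i) \<noteq> (\<lambda>i. 0)"
      using u(1) by (metis vec_eq_iff zero_index)
  qed (use u(2) in \<open>simp_all add: f_def prod_eq_iff\<close>)
qed

text \<open>
  Taking the inner product of the relation with \<open>x k\<close> gives \<open>(1 - c) * u k = - c * (\<Sum>i\<in>I. u i)\<close>, and the
  right-hand side does not depend on \<open>k\<close>.
\<close>

lemma equiangular_relation_constant:
  fixes x :: "'n \<Rightarrow> 'a::real_inner"
  assumes "finite I"
    and unit: "\<And>i. i \<in> I \<Longrightarrow> norm (x i) = 1"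
    and inner: "\<And>i j. i \<in> I \<Longrightarrow> j \<in> I \<Longrightarrow> i \<noteq> j \<Longrightarrow> x i \<bullet> x j = c" and "c \<noteq> 1"
    and relation: "(\<Sum>i\<in>I. u i *\<^sub>R x i) = 0"
    and "i \<in> I" and "j \<in> I"
  shows "u i = u j"
proof -
  have "(1 - c) * u k = - c * (\<Sum>i\<in>I. u i)" if "k \<in> I" for k
  proof -
    have "0 = x k \<bullet> (\<Sum>i\<in>I. u i *\<^sub>R x i)"
      by (simp add: relation)
    also have "\<dots> = (\<Sum>i\<in>I. u i * (x k \<bullet> x i))"
      by (simp add: inner_sum_right)
    also have "\<dots> = (\<Sum>i\<in>I. c * u i + (if i = k then (1 - c) * u i else 0))"
      using unit inner that by (intro sum.cong refl) (auto simp: norm_eq_1 algebra_simps)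
    also have "\<dots> = c * (\<Sum>i\<in>I. u i) + (1 - c) * u k"
      using that \<open>finite I\<close> by (simp add: sum.distrib sum_distrib_left)
    finally show ?thesis by simp
  qed
  then have "(1 - c) * u i = (1 - c) * u j"
    using \<open>i \<in> I\<close> \<open>j \<in> I\<close> by simp
  with \<open>c \<noteq> 1\<close> show ?thesis by simp
qed

text \<open>
  If the stress vanished, all the inner products would agree. Then every linear relation would have
  constant coefficients, but for so many points some nonzero relation has a zero coefficient.
\<close>

lemma stress_not_all_0:
  fixes x :: "(real ^ 'd) ^ 'n"
  assumes conf: "x \<in> configurations" and card: "CARD('d) + 1 < CARD('n)"
  shows "\<exists>i j. stress x i j \<noteq> 0"
proof (rule ccontr)
  assume "\<nexists>i j. stress x i j \<noteq> 0"
  then have zero: "stress x i j = 0" for i j by blast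
  define c where "c = 1 - 1 / (1 - 1 / real CARD('n))"
  have c: "x $ i \<bullet> x $ j = c" if "i \<noteq> j" for i j
    using zero[of i j] that by (simp add: stress_def weight_def c_def)
  have "c \<noteq> 1"
    using card by (simp add: c_def field_simps)
  fix k :: 'n
  obtain u where u: "u \<noteq> (\<lambda>i. 0)" "u k = 0" "(\<Sum>i\<in>UNIV. u i *\<^sub>R x $ i) = 0"
    using relation_vanishing_at[of k "($) x"] card by auto
  have "u i = u k" for i
    using equiangular_relation_constant[of UNIV "($) x" c u i k] configurationsD(1)[OF conf] c
      \<open>c \<noteq> 1\<close> u(3) by simp
  with u show False by auto
qed

text \<open>
  In a direction \<open>e\<close> orthogonal to all points the configuration can be moved with all \<open>h i\<close> multiples of
  \<open>e\<close>; this changes the inner products only to second order, so the squared term of the second variation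
  vanishes and the stress must be negative semidefinite on fields with sum zero.
\<close>

lemma local_minimum_spans:
  fixes x :: "(real ^ 'd) ^ 'n"
  assumes min: "log_local_minimum x" and card: "CARD('d) + 1 < CARD('n)"
    and perp: "\<And>i. e \<bullet> x $ i = 0"
  shows "e = 0"
proof (rule ccontr)
  assume "e \<noteq> 0"
  have conf: "x \<in> configurations"
    using min by (simp add: log_local_minimum_def)
  have card': "1 < CARD('n)" using card by simp
  have "stress x i i \<le> 0" for i
  proof -
    \<comment> \<open>The \<open>i\<close>-th unit vector, projected to sum zero; the projection does not change the value of the
      quadratic form of the stress, whose row sums are zero.\<close>
    define u where "u = (\<lambda>k. (if k = i then 1 else 0) - 1 / real CARD('n))"
    have sum_u: "(\<Sum>k\<in>UNIV. u k) = 0"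
      by (simp add: u_def sum_subtractf)
    have "(\<Sum>k\<in>UNIV. \<Sum>l\<in>UNIV. stress x k l * ((u k *\<^sub>R e) \<bullet> (u l *\<^sub>R e)))
       \<le> (1 - 1 / CARD('n)) * (norm (\<Sum>k\<in>UNIV. u k *\<^sub>R e))\<^sup>2
         + 1/2 * (\<Sum>k\<in>UNIV. \<Sum>l\<in>-{k}. (weight x k l * ((u k *\<^sub>R e) \<bullet> x $ l + x $ k \<bullet> (u l *\<^sub>R e)))\<^sup>2)"
      by (rule stress_second_variation[OF min]) (simp add: perp)
    also have "\<dots> = 0"
      using perp sum_u by (simp add: scaleR_left.sum[symmetric] inner_commute[of _ e])
    finally have "0 \<ge> (\<Sum>k\<in>UNIV. \<Sum>l\<in>UNIV. stress x k l * ((u k *\<^sub>R e) \<bullet> (u l *\<^sub>R e)))" .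
    moreover have "(\<Sum>k\<in>UNIV. \<Sum>l\<in>UNIV. stress x k l * ((u k *\<^sub>R e) \<bullet> (u l *\<^sub>R e)))
        = (\<Sum>k\<in>UNIV. u k * (\<Sum>l\<in>UNIV. stress x k l * u l)) * (e \<bullet> e)"
      by (simp add: sum_distrib_left sum_distrib_right ac_simps)
    moreover have contract: "(\<Sum>l\<in>UNIV. stress x k l * u l) = stress x k i" for k
    proof -
      have "(\<Sum>l\<in>UNIV. stress x k l * u l)
          = (\<Sum>l\<in>UNIV. (if l = i then stress x k l else 0) - stress x k l / real CARD('n))"
        by (intro sum.cong) (simp_all add: u_def right_diff_distrib)
      then show ?thesis
        using stress_row_sum[OF conf, of k] by (simp add: sum_subtractf sum_divide_distrib[symmetric])
    qed
    moreover have "(\<Sum>k\<in>UNIV. u k * stress x k i) = stress x i i"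
    proof -
      have "u k * stress x k i = stress x i k * u k" for k
        using stress_sym[of x k i] by simp
      then show ?thesis using contract[of i] by (simp only:)
    qed
    ultimately have "stress x i i * (e \<bullet> e) \<le> 0" by simp
    then show ?thesis
      using \<open>e \<noteq> 0\<close> inner_gt_zero_iff[of e] by (smt (verit) mult_pos_pos)
  qed
  then have "stress x i j = 0" for i j
    using stress_eq_0[OF min card'] by blast
  then show False
    using stress_not_all_0[OF conf card] by blast
qed

text \<open>
  The coordinate functions of the points together with the constants form a space of dimension
  \<open>d + 1\<close>, and the relations in question are orthogonal to it inside a space of dimension at most
  \<open>d + 2\<close>. So a nontrivial linear combination of \<open>d\<close> coordinate functions, the constant \<open>1\<close>, \<open>u\<close> and \<open>w\<close>
  vanishes; by orthogonality the part coming from \<open>u\<close> and \<open>w\<close> vanishes on its own.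
\<close>

lemma balanced_relations_proportional:
  fixes x :: "'n::finite \<Rightarrow> 'a::euclidean_space"
  assumes card: "CARD('n) \<le> DIM('a) + 2"
    and spans: "\<And>e. (\<And>i. e \<bullet> x i = 0) \<Longrightarrow> e = 0"
    and centroid: "(\<Sum>i\<in>UNIV. x i) = 0"
    and u: "(\<Sum>i\<in>UNIV. u i) = 0" "(\<Sum>i\<in>UNIV. u i *\<^sub>R x i) = 0"
    and w: "(\<Sum>i\<in>UNIV. w i) = 0" "(\<Sum>i\<in>UNIV. w i *\<^sub>R x i) = 0"
  obtains p q where "(p, q) \<noteq> (0, 0)" and "\<And>i. p * u i + q * w i = (0 :: real)"
proof -
  define f :: "'a \<times> real \<times> real \<times> real \<Rightarrow> real ^ 'n"
    where "f = (\<lambda>(z, s, p, q). \<chi> i. z \<bullet> x i + s + p * u i + q * w i)"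
  have "linear f"
    unfolding f_def by (rule linearI) (auto simp: vec_eq_iff inner_add_left algebra_simps)
  moreover have "DIM(real ^ 'n) < DIM('a \<times> real \<times> real \<times> real)"
    using card by simp
  ultimately obtain y where "y \<noteq> 0" "f y = 0"
    using linear_has_kernel by blast
  moreover obtain z s p q where "y = (z, s, p, q)"
    by (cases y) auto
  ultimately have nz: "(z, s, p, q) \<noteq> 0" and "f (z, s, p, q) = 0"
    by simp_all
  then have rel: "z \<bullet> x i + s + p * u i + q * w i = 0" for i
    by (simp add: f_def vec_eq_iff)
  \<comment> \<open>\<open>y\<close> is orthogonal to the rest of the combination, which equals \<open>- y\<close>, so \<open>y\<close> is zero.\<close>
  define y where "y = (\<lambda>i. p * u i + q * w i)"
  have y_sum: "(\<Sum>i\<in>UNIV. y i) = 0"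
    using u w by (simp add: y_def sum.distrib sum_distrib_left[symmetric])
  have y_x: "(\<Sum>i\<in>UNIV. y i * (z \<bullet> x i)) = 0"
  proof -
    have "(\<Sum>i\<in>UNIV. y i *\<^sub>R x i) = p *\<^sub>R (\<Sum>i\<in>UNIV. u i *\<^sub>R x i) + q *\<^sub>R (\<Sum>i\<in>UNIV. w i *\<^sub>R x i)"
      by (simp add: y_def scaleR_left_distrib sum.distrib scaleR_right.sum)
    then have "z \<bullet> (\<Sum>i\<in>UNIV. y i *\<^sub>R x i) = 0"
      using u w by simp
    then show ?thesis by (simp add: inner_sum_right)
  qed
  have "(\<Sum>i\<in>UNIV. (y i)\<^sup>2) = (\<Sum>i\<in>UNIV. - (y i * (z \<bullet> x i)) - s * y i)"
  proof (rule sum.cong)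
    fix i
    have "y i = - (z \<bullet> x i) - s"
      using rel[of i] by (simp add: y_def)
    then show "(y i)\<^sup>2 = - (y i * (z \<bullet> x i)) - s * y i"
      by (metis power2_eq_square right_diff_distrib mult_minus_right mult.commute)
  qed simp
  also have "\<dots> = 0"
    using y_sum y_x by (simp add: sum_subtractf sum_negf sum_distrib_left[symmetric])
  finally have y0: "y i = 0" for i
    by (subst (asm) sum_nonneg_eq_0_iff) auto
  then have zx: "z \<bullet> x i = - s" for i
    using rel[of i] y0[of i] unfolding y_def by linarith
  have "z \<bullet> (\<Sum>i\<in>UNIV. x i) = - s * real CARD('n)"
    by (simp add: inner_sum_right zx)
  then have "s = 0" using centroid by simp
  with zx spans have "z = 0" by simp
  show ?thesis
  proof (rule that)
    show "(p, q) \<noteq> (0, 0)" using nz \<open>s = 0\<close> \<open>z = 0\<close> by (auto simp: zero_prod_def)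
    show "p * u i + q * w i = 0" for i using y0[of i] by (simp add: y_def)
  qed
qed

text \<open>
  All rows of the stress lie on the line of balanced relations, and the stress is symmetric, so it is
  a multiple of \<open>v i * v j\<close>. The multiple is positive because the diagonal is nonnegative, and it is
  absorbed into \<open>v\<close>.
\<close>

lemma stress_rank_one:
  fixes x :: "(real ^ 'd) ^ 'n"
  assumes min: "log_local_minimum x" and card: "CARD('n) = CARD('d) + 2"
  obtains v where "\<And>i j. stress x i j = v i * v j" and "v \<noteq> (\<lambda>i. 0)"
    and "(\<Sum>i\<in>UNIV. v i) = 0" and "(\<Sum>i\<in>UNIV. v i *\<^sub>R x $ i) = 0"
proof -
  have conf: "x \<in> configurations"
    using min by (simp add: log_local_minimum_def)
  have card': "1 < CARD('n)" "CARD('d) + 1 < CARD('n)" using card by simp_all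
  obtain k where k: "0 < stress x k k"
    using stress_not_all_0[OF conf card'(2)] stress_eq_0[OF min card'(1)] by (metis not_le)
  have factor: "stress x i j * stress x k k = stress x k i * stress x k j" for i j
  proof -
    obtain p q where pq: "(p, q) \<noteq> (0, 0)" "\<And>j. p * stress x i j + q * stress x k j = 0"
      using balanced_relations_proportional[of "($) x" "stress x i" "stress x k"]
        card local_minimum_spans[OF min card'(2)] local_minimum_centroid[OF min card'(1)]
        stress_row_sum[OF conf] stress_equilibrium[OF min card'(1)]
      by auto
    have "p \<noteq> 0"
      using pq(1) pq(2)[of k] k by auto
    have "p * (stress x i j * stress x k k) = p * (stress x i k * stress x k j)"
      using pq(2)[of j] pq(2)[of k] by algebra
    with \<open>p \<noteq> 0\<close> show ?thesis
      by (simp add: stress_sym[of x i k])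
  qed
  define v where "v = (\<lambda>i. stress x k i / sqrt (stress x k k))"
  show ?thesis
  proof (rule that)
    show "stress x i j = v i * v j" for i j
      using factor[of i j] k by (simp add: v_def field_simps)
    show "v \<noteq> (\<lambda>i. 0)"
      using k by (auto simp: v_def fun_eq_iff intro!: exI[of _ k])
    show "(\<Sum>i\<in>UNIV. v i) = 0"
      using stress_row_sum[OF conf, of k] by (simp add: v_def sum_divide_distrib[symmetric])
    have "(\<Sum>i\<in>UNIV. v i *\<^sub>R x $ i) = (1 / sqrt (stress x k k)) *\<^sub>R (\<Sum>i\<in>UNIV. stress x k i *\<^sub>R x $ i)"
      by (simp add: v_def scaleR_right.sum)
    then show "(\<Sum>i\<in>UNIV. v i *\<^sub>R x $ i) = 0"
      by (simp add: stress_equilibrium[OF min card'(1)])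
  qed
qed

section \<open>No entry of the stress factor vanishes\<close>

lemma stress_factor_gram:
  fixes x :: "(real ^ 'd) ^ 'n"
  assumes conf: "x \<in> configurations" and stress: "\<And>i j. stress x i j = v i * v j"
  shows "(1 - 1 / CARD('n) - v i * v j) * (x $ i \<bullet> x $ j)
       = (if i = j then 1 else 0) - 1 / CARD('n) - v i * v j"
proof (cases "i = j")
  case True
  then show ?thesis by (simp add: configurationsD[OF conf])
next
  case False
  then have "weight x i j = 1 - 1 / CARD('n) - v i * v j"
    using stress[of i j] by (simp add: stress_def)
  then show ?thesis
    using weight_inner[OF conf False] False by simp
qed

text \<open>
  Multiply the identity of \<open>stress_factor_gram\<close> by \<open>v j\<close> and sum over \<open>j\<close>.
\<close>

lemma stress_factor_moment:
  fixes x :: "(real ^ 'd) ^ 'n"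
  assumes conf: "x \<in> configurations" and stress: "\<And>i j. stress x i j = v i * v j"
    and balance: "(\<Sum>i\<in>UNIV. v i) = 0" "(\<Sum>i\<in>UNIV. v i *\<^sub>R x $ i) = 0"
  shows "v i * (x $ i \<bullet> (\<Sum>j\<in>UNIV. (v j)\<^sup>2 *\<^sub>R x $ j)) = ((\<Sum>j\<in>UNIV. (v j)\<^sup>2) - 1) * v i"
proof -
  define \<alpha> where "\<alpha> = 1 - 1 / real CARD('n)"
  have "x $ i \<bullet> (\<Sum>j\<in>UNIV. v j *\<^sub>R x $ j) = 0"
    by (simp add: balance)
  then have orth: "(\<Sum>j\<in>UNIV. v j * (x $ i \<bullet> x $ j)) = 0"
    by (simp add: inner_sum_right)
  have "v i * (x $ i \<bullet> (\<Sum>j\<in>UNIV. (v j)\<^sup>2 *\<^sub>R x $ j))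
      = (\<Sum>j\<in>UNIV. v i * ((v j)\<^sup>2 * (x $ i \<bullet> x $ j)))"
    by (simp add: inner_sum_right sum_distrib_left)
  also have "\<dots> = (\<Sum>j\<in>UNIV. \<alpha> * (v j * (x $ i \<bullet> x $ j)) - (if j = i then v j else 0)
      + 1 / real CARD('n) * v j + v i * (v j)\<^sup>2)"
  proof (intro sum.cong refl)
    fix j
    have "(\<alpha> - v i * v j) * (x $ i \<bullet> x $ j) * v j
        = ((if i = j then 1 else 0) - 1 / CARD('n) - v i * v j) * v j"
      using stress_factor_gram[OF conf stress, of i j] by (simp add: \<alpha>_def)
    then show "v i * ((v j)\<^sup>2 * (x $ i \<bullet> x $ j)) = \<alpha> * (v j * (x $ i \<bullet> x $ j))
        - (if j = i then v j else 0) + 1 / real CARD('n) * v j + v i * (v j)\<^sup>2"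
      by (cases "i = j") (simp_all add: algebra_simps power2_eq_square)
  qed
  also have "\<dots> = \<alpha> * (\<Sum>j\<in>UNIV. v j * (x $ i \<bullet> x $ j)) - v i
      + 1 / real CARD('n) * (\<Sum>j\<in>UNIV. v j) + v i * (\<Sum>j\<in>UNIV. (v j)\<^sup>2)"
    by (simp add: sum.distrib sum_subtractf sum_distrib_left)
  finally show ?thesis
    using orth balance(1) by (simp add: algebra_simps)
qed

lemma stress_factor_moment_norm:
  fixes x :: "(real ^ 'd) ^ 'n"
  assumes conf: "x \<in> configurations" and stress: "\<And>i j. stress x i j = v i * v j"
    and balance: "(\<Sum>i\<in>UNIV. v i) = 0" "(\<Sum>i\<in>UNIV. v i *\<^sub>R x $ i) = 0"
  shows "(norm (\<Sum>j\<in>UNIV. (v j)\<^sup>2 *\<^sub>R x $ j))\<^sup>2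
       = ((\<Sum>j\<in>UNIV. (v j)\<^sup>2) - 1) * (\<Sum>j\<in>UNIV. (v j)\<^sup>2)"
proof -
  define s where "s = (\<Sum>j\<in>UNIV. (v j)\<^sup>2 *\<^sub>R x $ j)"
  define \<tau> where "\<tau> = (\<Sum>j\<in>UNIV. (v j)\<^sup>2)"
  have "(norm s)\<^sup>2 = (\<Sum>j\<in>UNIV. (v j)\<^sup>2 *\<^sub>R x $ j) \<bullet> s"
    by (simp add: power2_norm_eq_inner s_def)
  also have "\<dots> = (\<Sum>j\<in>UNIV. v j * (v j * (x $ j \<bullet> s)))"
    by (simp add: inner_sum_left power2_eq_square mult.assoc)
  also have "\<dots> = (\<Sum>j\<in>UNIV. (\<tau> - 1) * (v j)\<^sup>2)"
    using stress_factor_moment[OF assms]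
    by (intro sum.cong) (simp_all add: s_def \<tau>_def power2_eq_square)
  finally show ?thesis
    by (simp add: s_def \<tau>_def sum_distrib_left)
qed

text \<open>
  A point \<open>x $ k\<close> with \<open>v k = 0\<close> has the same inner product \<open>g = - 1 / (N - 1)\<close> with all other points.
  Let \<open>h i\<close> be \<open>v i\<close> times the tangential part of \<open>x $ k\<close> at \<open>x $ i\<close>. Both \<open>\<Sum>i. v i\<close> and
  \<open>\<Sum>i. v i *\<^sub>R x $ i\<close> are zero, so the field \<open>h\<close> has sum zero, and its second variation can be computed
  from \<open>g\<close> and \<open>\<tau>\<close> alone: it is \<open>\<tau> * (1 + g) * (1 - \<tau> * (1 - g))\<close>, which is negative
  since \<open>\<tau> \<ge> 1\<close> and \<open>-1 < g < 0\<close>.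
\<close>

lemma stress_factor_nonzero:
  fixes x :: "(real ^ 'd) ^ 'n"
  assumes min: "log_local_minimum x" and card: "2 < CARD('n)"
    and stress: "\<And>i j. stress x i j = v i * v j" and "v \<noteq> (\<lambda>i. 0)"
    and balance: "(\<Sum>i\<in>UNIV. v i) = 0" "(\<Sum>i\<in>UNIV. v i *\<^sub>R x $ i) = 0"
  shows "v k \<noteq> 0"
proof
  assume vk: "v k = 0"
  have conf: "x \<in> configurations"
    using min by (simp add: log_local_minimum_def)
  define N where "N = real CARD('n)"
  have N: "2 < N" using card by (simp add: N_def)
  define g where "g = - 1 / (N - 1)"
  define s where "s = (\<Sum>j\<in>UNIV. (v j)\<^sup>2 *\<^sub>R x $ j)"
  define \<tau> where "\<tau> = (\<Sum>j\<in>UNIV. (v j)\<^sup>2)"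
  have g: "g < 0" "-1 < g" "g * (N - 1) = -1"
    using N by (simp_all add: g_def field_simps)
  have gram_k: "x $ k \<bullet> x $ j = g" if "j \<noteq> k" for j
  proof -
    have "(1 - 1 / N) * (x $ k \<bullet> x $ j) = - 1 / N"
      using stress_factor_gram[OF conf stress, of k j] that vk by (simp add: N_def)
    then have "N * (1 - 1 / N) * (x $ k \<bullet> x $ j) = - 1"
      using N by (simp add: mult.assoc)
    then have "(N - 1) * (x $ k \<bullet> x $ j) = - 1"
      using N by (simp add: right_diff_distrib)
    then show ?thesis
      using N by (simp add: g_def field_simps)
  qed
  have weight_k: "weight x k j = 1 / (1 - g)" if "j \<noteq> k" for j
    using gram_k[OF that] by (simp add: weight_def)
  obtain i where "v i \<noteq> 0"
    using \<open>v \<noteq> (\<lambda>i. 0)\<close> by auto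
  then have "0 < \<tau>"
    unfolding \<tau>_def by (intro sum_pos2[of _ i]) auto
  have norm_s: "(norm s)\<^sup>2 = (\<tau> - 1) * \<tau>"
    using stress_factor_moment_norm[OF conf stress balance] by (simp add: s_def \<tau>_def)
  have "1 \<le> \<tau>"
    using norm_s \<open>0 < \<tau>\<close> zero_le_power2[of "norm s"] by (simp add: zero_le_mult_iff)
  have s_k: "x $ k \<bullet> s = g * \<tau>"
  proof -
    have "x $ k \<bullet> s = (\<Sum>j\<in>UNIV. (v j)\<^sup>2 * (x $ k \<bullet> x $ j))"
      by (simp add: s_def inner_sum_right)
    also have "\<dots> = (\<Sum>j\<in>UNIV. g * (v j)\<^sup>2)"
    proof (intro sum.cong refl)
      fix j show "(v j)\<^sup>2 * (x $ k \<bullet> x $ j) = g * (v j)\<^sup>2"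
        using gram_k[of j] vk by (cases "j = k") simp_all
    qed
    finally show ?thesis by (simp add: \<tau>_def sum_distrib_left)
  qed
  define h where "h = (\<lambda>i. v i *\<^sub>R (x $ k - g *\<^sub>R x $ i))"
  define b where "b = (\<lambda>i j. h i \<bullet> x $ j + x $ i \<bullet> h j)"
  have tangent: "h i \<bullet> x $ i = 0" for i
    using gram_k[of i] vk
    by (cases "i = k") (simp_all add: h_def inner_diff_left configurationsD[OF conf])
  have "(\<Sum>i\<in>UNIV. h i) = (\<Sum>i\<in>UNIV. v i) *\<^sub>R x $ k - g *\<^sub>R (\<Sum>i\<in>UNIV. v i *\<^sub>R x $ i)"
    by (simp add: h_def scaleR_right_diff_distrib sum_subtractf scaleR_left.sum scaleR_right.sum ac_simps)
  then have sum_h: "(\<Sum>i\<in>UNIV. h i) = 0"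
    by (simp add: balance)
  have "(\<Sum>i\<in>UNIV. \<Sum>j\<in>UNIV. stress x i j * (h i \<bullet> h j)) = (norm (\<Sum>i\<in>UNIV. v i *\<^sub>R h i))\<^sup>2"
    unfolding power2_norm_eq_inner inner_sum_left inner_sum_right
    by (subst sum.swap) (simp add: stress inner_commute ac_simps)
  also have "(\<Sum>i\<in>UNIV. v i *\<^sub>R h i) = \<tau> *\<^sub>R x $ k - g *\<^sub>R s"
    by (simp add: h_def scaleR_right_diff_distrib sum_subtractf power2_eq_square s_def \<tau>_def
        scaleR_left.sum scaleR_right.sum ac_simps)
  also have "(norm (\<tau> *\<^sub>R x $ k - g *\<^sub>R s))\<^sup>2 = \<tau>\<^sup>2 - 2 * g * \<tau> * (x $ k \<bullet> s) + g\<^sup>2 * (norm s)\<^sup>2"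
    unfolding power2_norm_eq_inner
    by (simp add: inner_diff_left inner_diff_right configurationsD[OF conf] inner_commute
        power2_eq_square algebra_simps)
  also have "\<dots> = \<tau>\<^sup>2 - 2 * g\<^sup>2 * \<tau>\<^sup>2 + g\<^sup>2 * ((\<tau> - 1) * \<tau>)"
    unfolding s_k norm_s by (simp add: power2_eq_square)
  finally have bending: "(\<Sum>i\<in>UNIV. \<Sum>j\<in>UNIV. stress x i j * (h i \<bullet> h j))
      = \<tau>\<^sup>2 - 2 * g\<^sup>2 * \<tau>\<^sup>2 + g\<^sup>2 * ((\<tau> - 1) * \<tau>)" .
  \<comment> \<open>Off the spokes from \<open>k\<close> the weight cancels exactly: \<open>b i j\<close> is \<open>g * (v i + v j)\<close> times
    \<open>1 - x $ i \<bullet> x $ j\<close>. On a spoke the value is \<open>(1 + g) * v j\<close>, and \<open>spoke\<close> carries the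
    difference of the squares, as \<open>(1 + g)\<^sup>2 - g\<^sup>2 = 1 + 2 * g\<close>.\<close>
  define spoke where "spoke = (\<lambda>i j. (if i = k then (v j)\<^sup>2 else 0) + (if j = k then (v i)\<^sup>2 else 0))"
  have strain: "(weight x i j * b i j)\<^sup>2
      = g\<^sup>2 * (v i + v j)\<^sup>2 + (1 + 2 * g) * spoke i j"
    if "j \<in> -{i}" for i j
  proof -
    have "i \<noteq> j" using that by simp
    then have lt: "x $ i \<bullet> x $ j < 1"
      using inner_less_1[of "x $ i" "x $ j"] configurationsD[OF conf] by simp
    have k_case: "(weight x k j * (v j * (1 - g * g)))\<^sup>2 = g\<^sup>2 * (v j)\<^sup>2 + (1 + 2 * g) * (v j)\<^sup>2"
      if "j \<noteq> k" for j
    proof -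
      have "weight x k j * (v j * (1 - g * g)) = v j * (1 + g)"
        using g(1) by (simp add: weight_k[OF that] field_simps)
      then show ?thesis
        by (simp only:) (simp add: power2_eq_square algebra_simps)
    qed
    consider "i = k" | "j = k" | "i \<noteq> k" "j \<noteq> k" by blast
    then show ?thesis
    proof cases
      case 1
      then have "b i j = v j * (1 - g * g)"
        using \<open>i \<noteq> j\<close> vk
        by (simp add: b_def h_def inner_diff_right configurationsD[OF conf] gram_k)
      with k_case[of j] 1 \<open>i \<noteq> j\<close> vk show ?thesis by (simp add: spoke_def)
    next
      case 2
      then have "b i j = v i * (1 - g * g)"
        using \<open>i \<noteq> j\<close> vk
        by (simp add: b_def h_def inner_diff_left inner_commute[of "x $ i"] configurationsD[OF conf] gram_k)
      with k_case[of i] 2 \<open>i \<noteq> j\<close> vk show ?thesis by (simp add: spoke_def weight_sym[of x i])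
    next
      case 3
      then have "b i j = g * (v i + v j) * (1 - x $ i \<bullet> x $ j)"
        using gram_k[of i] gram_k[of j]
        by (simp add: b_def h_def inner_diff_left inner_diff_right inner_commute[of "x $ i" "x $ k"]
            algebra_simps)
      then have "weight x i j * b i j = g * (v i + v j)"
        using lt by (simp add: weight_def)
      then show ?thesis using 3 by (simp add: spoke_def power_mult_distrib)
    qed
  qed
  have pairs: "(\<Sum>i\<in>UNIV. \<Sum>j\<in>-{i}. (v i + v j)\<^sup>2) = 2 * (N - 2) * \<tau>"
  proof -
    have "(\<Sum>j\<in>-{i}. (v i + v j)\<^sup>2) = (N - 4) * (v i)\<^sup>2 + \<tau>" for i
    proof -
      have "(\<Sum>j\<in>-{i}. (v i + v j)\<^sup>2) = (\<Sum>j\<in>UNIV. (v i)\<^sup>2 + (v j)\<^sup>2 + 2 * v i * v j) - (v i + v i)\<^sup>2"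
        unfolding sum_except by (simp only: power2_sum)
      also have "\<dots> = N * (v i)\<^sup>2 + \<tau> + 2 * v i * (\<Sum>j\<in>UNIV. v j) - (v i + v i)\<^sup>2"
        by (simp add: sum.distrib sum_distrib_left N_def \<tau>_def)
      also have "(v i + v i)\<^sup>2 = 4 * (v i)\<^sup>2"
        by (simp add: power2_eq_square)
      finally show ?thesis
        by (simp add: balance algebra_simps)
    qed
    then have "(\<Sum>i\<in>UNIV. \<Sum>j\<in>-{i}. (v i + v j)\<^sup>2) = (\<Sum>i\<in>UNIV. (N - 4) * (v i)\<^sup>2) + N * \<tau>"
      by (simp add: sum.distrib N_def)
    also have "(\<Sum>i\<in>UNIV. (N - 4) * (v i)\<^sup>2) = (N - 4) * \<tau>"
      by (simp only: sum_distrib_left \<tau>_def)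
    finally show ?thesis
      by (simp add: algebra_simps)
  qed
  have "(\<Sum>i\<in>UNIV. \<Sum>j\<in>-{i}. (if i = k then (v j)\<^sup>2 else 0)) = \<tau>"
  proof -
    have "(\<Sum>j\<in>-{i}. (if i = k then (v j)\<^sup>2 else 0)) = (if i = k then \<tau> else 0)" for i
      using vk by (simp add: sum_except \<tau>_def)
    then show ?thesis by simp
  qed
  moreover from this have "(\<Sum>i\<in>UNIV. \<Sum>j\<in>-{i}. (if j = k then (v i)\<^sup>2 else 0)) = \<tau>"
    by (subst sum_offdiagonal_swap)
  ultimately have spokes: "(\<Sum>i\<in>UNIV. \<Sum>j\<in>-{i}. spoke i j) = 2 * \<tau>"
    by (simp add: spoke_def sum.distrib)
  have "(\<Sum>i\<in>UNIV. \<Sum>j\<in>-{i}. (weight x i j * b i j)\<^sup>2)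
      = (\<Sum>i\<in>UNIV. \<Sum>j\<in>-{i}. g\<^sup>2 * (v i + v j)\<^sup>2
          + (1 + 2 * g) * spoke i j)"
    using strain by simp
  also have "\<dots> = g\<^sup>2 * (\<Sum>i\<in>UNIV. \<Sum>j\<in>-{i}. (v i + v j)\<^sup>2)
      + (1 + 2 * g) * (\<Sum>i\<in>UNIV. \<Sum>j\<in>-{i}. spoke i j)"
    by (simp only: sum.distrib sum_distrib_left)
  finally have stretching: "(\<Sum>i\<in>UNIV. \<Sum>j\<in>-{i}. (weight x i j * b i j)\<^sup>2)
      = g\<^sup>2 * (2 * (N - 2) * \<tau>) + (1 + 2 * g) * (2 * \<tau>)"
    unfolding pairs spokes .
  have "\<tau>\<^sup>2 - 2 * g\<^sup>2 * \<tau>\<^sup>2 + g\<^sup>2 * ((\<tau> - 1) * \<tau>)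
      \<le> 1/2 * (g\<^sup>2 * (2 * (N - 2) * \<tau>) + (1 + 2 * g) * (2 * \<tau>))"
    using stress_second_variation[OF min, of h] tangent
    unfolding sum_h bending stretching[unfolded b_def] by simp
  also have "\<dots> = g\<^sup>2 * (N - 2) * \<tau> + (1 + 2 * g) * \<tau>"
    by (simp add: algebra_simps)
  finally have "\<tau>\<^sup>2 - 2 * g\<^sup>2 * \<tau>\<^sup>2 + g\<^sup>2 * ((\<tau> - 1) * \<tau>)
      \<le> g\<^sup>2 * (N - 2) * \<tau> + (1 + 2 * g) * \<tau>" .
  moreover have "g\<^sup>2 * (N - 2) = - g - g\<^sup>2"
    using g(3) unfolding power2_eq_square by algebra
  ultimately have "\<tau>\<^sup>2 - 2 * g\<^sup>2 * \<tau>\<^sup>2 + g\<^sup>2 * ((\<tau> - 1) * \<tau>) \<le> (- g - g\<^sup>2) * \<tau> + (1 + 2 * g) * \<tau>"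
    by (simp only:)
  then have "0 \<le> \<tau> * ((1 + g) * (1 - \<tau> * (1 - g)))"
    by (simp add: power2_eq_square algebra_simps)
  moreover have "1 < \<tau> * (1 - g)"
    using \<open>1 \<le> \<tau>\<close> g(1) by (intro less_le_trans[OF _ mult_right_mono[of 1 \<tau> "1 - g"]]) simp_all
  then have "\<tau> * ((1 + g) * (1 - \<tau> * (1 - g))) < 0"
    using \<open>0 < \<tau>\<close> g(2) by (simp add: mult_less_0_iff)
  ultimately show False by simp
qed

section \<open>Local minima are pairs of orthogonal simplexes\<close>

text \<open>
  The labelled form of two orthogonal regular simplexes: the points with index in \<open>I\<close> form one of them
  and the remaining points the other.
\<close>

definition orthogonal_simplex_pair :: "'n set \<Rightarrow> (real ^ 'd) ^ 'n \<Rightarrow> bool" where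
  "orthogonal_simplex_pair I x \<longleftrightarrow>
     (\<forall>i\<in>I. \<forall>j\<in>-I. x $ i \<bullet> x $ j = 0) \<and>
     (\<exists>c. \<forall>i\<in>I. \<forall>j\<in>I. i \<noteq> j \<longrightarrow> x $ i \<bullet> x $ j = c) \<and>
     (\<exists>c. \<forall>i\<in>-I. \<forall>j\<in>-I. i \<noteq> j \<longrightarrow> x $ i \<bullet> x $ j = c)"

lemma orthogonal_simplex_pair_Compl:
  "orthogonal_simplex_pair (- I) x \<longleftrightarrow> orthogonal_simplex_pair I x"
proof -
  have "(\<forall>i\<in>-I. \<forall>j\<in>I. x $ i \<bullet> x $ j = 0) \<longleftrightarrow> (\<forall>i\<in>I. \<forall>j\<in>-I. x $ i \<bullet> x $ j = 0)"
    by (metis inner_commute)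
  then show ?thesis
    unfolding orthogonal_simplex_pair_def double_complement by blast
qed

text \<open>
  The two classes are the indices with positive and with negative \<open>v\<close>. Neither is empty since \<open>v\<close> is
  nonzero with sum zero, and neither is a singleton since a point orthogonal to all others would
  contradict that the centroid is \<open>0\<close>.
\<close>

proposition local_minimum_simplex_pair:
  fixes x :: "(real ^ 'd) ^ 'n"
  assumes min: "log_local_minimum x" and card: "CARD('n) = CARD('d) + 2"
  obtains I where "orthogonal_simplex_pair I x" and "2 \<le> card I" and "2 \<le> card (- I)"
proof -
  have conf: "x \<in> configurations"
    using min by (simp add: log_local_minimum_def)
  have card': "1 < CARD('n)" "2 < CARD('n)" "CARD('d) + 1 < CARD('n)"
    using card zero_less_card_finite[where 'a = 'd] by linarith+
  obtain v where stress: "\<And>i j. stress x i j = v i * v j" and "v \<noteq> (\<lambda>i. 0)"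
    and balance: "(\<Sum>i\<in>UNIV. v i) = 0" "(\<Sum>i\<in>UNIV. v i *\<^sub>R x $ i) = 0"
    using stress_rank_one[OF min card] by blast
  have nonzero: "v i \<noteq> 0" for i
    using stress_factor_nonzero[OF min card'(2) stress \<open>v \<noteq> (\<lambda>i. 0)\<close> balance] .
  define s where "s = (\<Sum>j\<in>UNIV. (v j)\<^sup>2 *\<^sub>R x $ j)"
  define \<tau> where "\<tau> = (\<Sum>j\<in>UNIV. (v j)\<^sup>2)"
  have centroid: "(\<Sum>i\<in>UNIV. x $ i) = 0"
    using local_minimum_centroid[OF min card'(1)] .
  have "x $ i \<bullet> s = \<tau> - 1" for i
    using stress_factor_moment[OF conf stress balance, of i] nonzero[of i]
    by (simp add: s_def \<tau>_def)
  then have "real CARD('n) * (\<tau> - 1) = (\<Sum>i\<in>UNIV. x $ i \<bullet> s)"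
    by simp
  also have "\<dots> = 0"
    by (simp add: inner_sum_left[symmetric] centroid)
  finally have "\<tau> = 1" by simp
  then have "s = 0"
    using stress_factor_moment_norm[OF conf stress balance] by (simp add: s_def \<tau>_def)
  \<comment> \<open>Subtracting the mean \<open>\<tau> / N = 1 / N\<close> makes the squares a balanced relation; it must be proportional
    to \<open>v\<close>.\<close>
  define w where "w = (\<lambda>i. (v i)\<^sup>2 - 1 / real CARD('n))"
  have "(\<Sum>i\<in>UNIV. w i) = 0"
    using \<open>\<tau> = 1\<close> by (simp add: w_def sum_subtractf \<tau>_def)
  moreover have "(\<Sum>i\<in>UNIV. w i *\<^sub>R x $ i) = s - (1 / real CARD('n)) *\<^sub>R (\<Sum>i\<in>UNIV. x $ i)"
    by (simp add: w_def s_def scaleR_left_diff_distrib sum_subtractf scaleR_right.sum)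
  then have "(\<Sum>i\<in>UNIV. w i *\<^sub>R x $ i) = 0"
    using \<open>s = 0\<close> centroid by simp
  ultimately obtain p q where pq: "(p, q) \<noteq> (0, 0)" "\<And>i. p * v i + q * w i = 0"
    using balanced_relations_proportional[of "($) x" v w] card balance centroid
      local_minimum_spans[OF min card'(3)] by auto
  have "q \<noteq> 0"
    using pq nonzero by auto
  define b where "b = - p / q"
  have "w i = b * v i" for i
    using pq(2)[of i] \<open>q \<noteq> 0\<close> by (simp add: b_def field_simps)
  then have quadratic: "v i * v i = 1 / real CARD('n) + b * v i" for i
    by (simp add: w_def power2_eq_square algebra_simps)
  \<comment> \<open>Two different roots of \<open>t\<^sup>2 - b * t - 1 / N\<close> have product \<open>- 1 / N\<close>.\<close>
  have two_values: "v i = v j \<or> v i * v j = - 1 / real CARD('n)" for i j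
  proof -
    have "(v i - v j) * (v i + v j - b) = 0"
      using quadratic[of i] quadratic[of j] by (simp add: algebra_simps)
    then have "v i = v j \<or> v j = b - v i" by auto
    then show ?thesis
      using quadratic[of i] by (auto simp: algebra_simps)
  qed
  have opposite: "x $ i \<bullet> x $ j = 0" if "v i * v j < 0" for i j
  proof -
    have "i \<noteq> j" "v i \<noteq> v j" using that by (auto simp: mult_less_0_iff)
    then have "v i * v j = - 1 / real CARD('n)"
      using two_values[of i j] by simp
    then have "weight x i j = 1"
      using stress[of i j] \<open>i \<noteq> j\<close> by (simp add: stress_def)
    then show ?thesis by (simp add: weight_def field_simps)
  qed
  have same: "v i = v j" if "0 < v i * v j" for i j
  proof -
    have "v i * v j \<noteq> - 1 / real CARD('n)"
    proof
      assume "v i * v j = - 1 / real CARD('n)"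
      then have "v i * v j < 0" by (simp add: divide_neg_pos)
      with that show False by simp
    qed
    then show ?thesis using two_values[of i j] by simp
  qed
  have equiangular: "x $ i \<bullet> x $ j = x $ k \<bullet> x $ l"
    if "i \<noteq> j" "k \<noteq> l" "v i = v k" "v j = v l" for i j k l
  proof -
    have "weight x i j = weight x k l"
      using stress[of i j] stress[of k l] that by (simp add: stress_def)
    moreover have "x $ i \<bullet> x $ j < 1" "x $ k \<bullet> x $ l < 1"
      using inner_less_1 configurationsD[OF conf] that by metis+
    ultimately show ?thesis by (simp add: weight_def)
  qed
  define I where "I = {i. 0 < v i}"
  have Compl_I: "- I = {i. v i < 0}"
    using nonzero by (auto simp: I_def not_less order_le_less)
  have equal_inner: "\<exists>c. \<forall>i\<in>J. \<forall>j\<in>J. i \<noteq> j \<longrightarrow> x $ i \<bullet> x $ j = c"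
    if "\<And>i j. i \<in> J \<Longrightarrow> j \<in> J \<Longrightarrow> 0 < v i * v j" for J
  proof (cases "\<exists>k\<in>J. \<exists>l\<in>J. k \<noteq> l")
    case True
    then obtain k l where "k \<in> J" "l \<in> J" "k \<noteq> l" by blast
    then show ?thesis
      using equiangular same that by (intro exI[of _ "x $ k \<bullet> x $ l"]) blast
  qed auto
  have two: "2 \<le> card J" if J: "\<And>i j. i \<in> J \<Longrightarrow> j \<notin> J \<Longrightarrow> v i * v j < 0" "J \<noteq> {}" for J
  proof (rule ccontr)
    assume "\<not> 2 \<le> card J"
    moreover have "0 < card J"
      using J(2) by (simp add: card_gt_0_iff)
    ultimately have "card J = 1" by linarith
    then obtain k where k: "J = {k}" by (auto simp: card_1_singleton_iff)
    have "x $ k \<bullet> (\<Sum>j\<in>UNIV. x $ j) = (\<Sum>j\<in>UNIV. if j = k then 1 else 0)"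
      unfolding inner_sum_right
      using opposite J(1)[of k] k by (intro sum.cong) (auto simp: configurationsD[OF conf])
    then show False by (simp add: centroid)
  qed
  have "\<exists>i. 0 < v i" "\<exists>i. v i < 0"
  proof -
    fix k :: 'n
    show "\<exists>i. 0 < v i"
    proof (rule ccontr)
      assume "\<nexists>i. 0 < v i"
      then have "\<forall>i. v i \<le> 0" by (auto simp: not_less)
      then have "v k = 0"
        using balance(1) sum_nonneg_eq_0_iff[of UNIV "\<lambda>i. - v i"] by (simp add: sum_negf)
      with nonzero show False by blast
    qed
    show "\<exists>i. v i < 0"
    proof (rule ccontr)
      assume "\<nexists>i. v i < 0"
      then have "\<forall>i. 0 \<le> v i" by (auto simp: not_less)
      then have "v k = 0"
        using balance(1) sum_nonneg_eq_0_iff[of UNIV v] by simp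
      with nonzero show False by blast
    qed
  qed
  show ?thesis
  proof (rule that)
    show "orthogonal_simplex_pair I x"
      unfolding orthogonal_simplex_pair_def
    proof (intro conjI)
      show "\<forall>i\<in>I. \<forall>j\<in>-I. x $ i \<bullet> x $ j = 0"
        unfolding Compl_I by (auto simp: I_def mult_pos_neg intro!: opposite)
      show "\<exists>c. \<forall>i\<in>I. \<forall>j\<in>I. i \<noteq> j \<longrightarrow> x $ i \<bullet> x $ j = c"
        by (rule equal_inner) (simp add: I_def)
      show "\<exists>c. \<forall>i\<in>-I. \<forall>j\<in>-I. i \<noteq> j \<longrightarrow> x $ i \<bullet> x $ j = c"
        unfolding Compl_I by (rule equal_inner) (simp add: mult_neg_neg)
    qed
    show "2 \<le> card I"
    proof (rule two)
      show "v i * v j < 0" if "i \<in> I" "j \<notin> I" for i j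
        using that Compl_I by (auto simp: I_def mult_less_0_iff)
    qed (use \<open>\<exists>i. 0 < v i\<close> in \<open>auto simp: I_def\<close>)
    show "2 \<le> card (- I)"
    proof (rule two)
      show "v i * v j < 0" if "i \<in> - I" "j \<notin> - I" for i j
        using that Compl_I by (auto simp: I_def mult_less_0_iff)
    qed (use \<open>\<exists>i. v i < 0\<close> in \<open>auto simp: Compl_I\<close>)
  qed
qed

section \<open>Pairs of orthogonal simplexes are determined by their sizes\<close>

lemma equiangular_if_regular_simplex:
  assumes simplex: "regular_simplex m (($) x ` I)" and conf: "x \<in> configurations"
  shows "\<exists>c. \<forall>i\<in>I. \<forall>j\<in>I. i \<noteq> j \<longrightarrow> x $ i \<bullet> x $ j = c"
proof -
  obtain r where r: "\<And>y z. y \<in> ($) x ` I \<Longrightarrow> z \<in> ($) x ` I \<Longrightarrow> y \<noteq> z \<Longrightarrow> dist y z = r"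
    using simplex unfolding regular_simplex_def by metis
  have "x $ i \<bullet> x $ j = 1 - r\<^sup>2 / 2" if "i \<in> I" "j \<in> I" "i \<noteq> j" for i j
    using r[of "x $ i" "x $ j"] that dist_unit_vectors[of "x $ i" "x $ j"] configurationsD[OF conf]
    by (simp add: field_simps)
  then show ?thesis by blast
qed

lemma regular_simplex_if_equiangular:
  fixes x :: "(real ^ 'd) ^ 'n"
  assumes conf: "x \<in> configurations"
    and c: "\<And>i j. i \<in> I \<Longrightarrow> j \<in> I \<Longrightarrow> i \<noteq> j \<Longrightarrow> x $ i \<bullet> x $ j = c"
  shows "regular_simplex (card I) (($) x ` I)"
proof -
  have "inj_on (($) x) I"
    using conf by (auto simp: configurations_def intro: inj_on_subset)
  moreover have "dist (x $ i) (x $ j) = sqrt (2 - 2 * c)" if "i \<in> I" "j \<in> I" "i \<noteq> j" for i j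
    using dist_unit_vectors[of "x $ i" "x $ j"] configurationsD(1)[OF conf] c[OF that]
    by (metis real_sqrt_unique zero_le_dist)
  ultimately show ?thesis
    by (auto simp: regular_simplex_def card_image intro!: exI[of _ "sqrt (2 - 2 * c)"])
qed

lemma two_orthogonal_simplexes_range_iff:
  fixes x :: "(real ^ 'd) ^ 'n"
  assumes conf: "x \<in> configurations"
  shows "two_orthogonal_simplexes m n (range (($) x))
     \<longleftrightarrow> (\<exists>I. orthogonal_simplex_pair I x \<and> card I = m \<and> card (- I) = n)"
proof
  assume "two_orthogonal_simplexes m n (range (($) x))"
  then obtain Y Z where YZ: "range (($) x) = Y \<union> Z" "regular_simplex m Y" "regular_simplex n Z"
    and "\<forall>y\<in>Y. \<forall>z\<in>Z. orthogonal y z"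
    unfolding two_orthogonal_simplexes_def by blast
  then have orth: "y \<bullet> z = 0" if "y \<in> Y" "z \<in> Z" for y z
    using that by (simp add: orthogonal_def)
  have inj: "inj (($) x)"
    using conf by (simp add: configurations_def)
  define I where "I = {i. x $ i \<in> Y}"
  have disjoint: "x $ i \<notin> Z" if "x $ i \<in> Y" for i
    using orth[OF that, of "x $ i"] configurationsD(2)[OF conf, of i] by auto
  have "Y \<subseteq> range (($) x)" "Z \<subseteq> range (($) x)" and covered: "x $ i \<in> Y \<or> x $ i \<in> Z" for i
    using YZ(1) by auto
  then have Y: "($) x ` I = Y" and Z: "($) x ` (- I) = Z"
    using disjoint unfolding I_def by blast+
  have "card I = m" "card (- I) = n"
    using YZ(2,3) card_image[OF inj_on_subset[OF inj subset_UNIV], of I]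
      card_image[OF inj_on_subset[OF inj subset_UNIV], of "- I"]
    by (simp_all add: regular_simplex_def Y Z)
  moreover have "orthogonal_simplex_pair I x"
    unfolding orthogonal_simplex_pair_def
  proof (intro conjI)
    show "\<exists>c. \<forall>i\<in>I. \<forall>j\<in>I. i \<noteq> j \<longrightarrow> x $ i \<bullet> x $ j = c"
      using equiangular_if_regular_simplex[of m x I] YZ Y conf by simp
    show "\<exists>c. \<forall>i\<in>-I. \<forall>j\<in>-I. i \<noteq> j \<longrightarrow> x $ i \<bullet> x $ j = c"
      using equiangular_if_regular_simplex[of n x "- I"] YZ Z conf by simp
    show "\<forall>i\<in>I. \<forall>j\<in>-I. x $ i \<bullet> x $ j = 0"
      using orth Y Z by blast
  qed
  ultimately show "\<exists>I. orthogonal_simplex_pair I x \<and> card I = m \<and> card (- I) = n"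
    by blast
next
  assume "\<exists>I. orthogonal_simplex_pair I x \<and> card I = m \<and> card (- I) = n"
  then obtain I where I: "orthogonal_simplex_pair I x" "card I = m" "card (- I) = n" by blast
  then obtain c c' where c: "\<And>i j. i \<in> I \<Longrightarrow> j \<in> I \<Longrightarrow> i \<noteq> j \<Longrightarrow> x $ i \<bullet> x $ j = c"
    and c': "\<And>i j. i \<in> - I \<Longrightarrow> j \<in> - I \<Longrightarrow> i \<noteq> j \<Longrightarrow> x $ i \<bullet> x $ j = c'"
    and orth: "\<And>i j. i \<in> I \<Longrightarrow> j \<in> - I \<Longrightarrow> x $ i \<bullet> x $ j = 0"
    unfolding orthogonal_simplex_pair_def by metis
  show "two_orthogonal_simplexes m n (range (($) x))"
    unfolding two_orthogonal_simplexes_def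
  proof (rule exI[of _ "($) x ` I"], rule exI[of _ "($) x ` (- I)"], intro conjI)
    show "range (($) x) = ($) x ` I \<union> ($) x ` (- I)"
      by (simp add: image_Un[symmetric])
    show "regular_simplex m (($) x ` I)"
      using regular_simplex_if_equiangular[OF conf c] I(2) by blast
    show "regular_simplex n (($) x ` (- I))"
      using regular_simplex_if_equiangular[OF conf c'] I(3) by blast
  qed (use orth in \<open>auto simp: configurationsD[OF conf] orthogonal_def\<close>)
qed

text \<open>
  A relation splits into one relation for each class, because the two partial sums are orthogonal and
  add up to \<open>0\<close>.
\<close>

lemma orthogonal_simplex_pair_relation:
  fixes x :: "(real ^ 'd) ^ 'n"
  assumes conf: "x \<in> configurations" and pair: "orthogonal_simplex_pair I x" and two: "2 \<le> card I"
    and relation: "(\<Sum>i\<in>UNIV. u i *\<^sub>R x $ i) = 0"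
  shows "(\<Sum>i\<in>I. u i *\<^sub>R x $ i) = 0" and "i \<in> I \<Longrightarrow> j \<in> I \<Longrightarrow> u i = u j"
proof -
  obtain c where c: "\<And>i j. i \<in> I \<Longrightarrow> j \<in> I \<Longrightarrow> i \<noteq> j \<Longrightarrow> x $ i \<bullet> x $ j = c"
    and orth: "\<And>i j. i \<in> I \<Longrightarrow> j \<in> - I \<Longrightarrow> x $ i \<bullet> x $ j = 0"
    using pair unfolding orthogonal_simplex_pair_def by metis
  define y where "y = (\<Sum>i\<in>I. u i *\<^sub>R x $ i)"
  define z where "z = (\<Sum>i\<in>-I. u i *\<^sub>R x $ i)"
  have "y + z = 0"
    using relation sum.union_disjoint[of I "- I" "\<lambda>i. u i *\<^sub>R x $ i"] by (simp add: y_def z_def)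
  moreover have "y \<bullet> z = 0"
    unfolding y_def z_def inner_sum_left inner_sum_right
    by (intro sum.neutral ballI) (simp add: orth)
  ultimately have "y \<bullet> y = 0"
    by (metis inner_add_right inner_zero_right add_0_right)
  then show zero: "(\<Sum>i\<in>I. u i *\<^sub>R x $ i) = 0"
    by (simp add: y_def)
  obtain k l where kl: "k \<in> I" "l \<in> I" "k \<noteq> l"
    using two by (metis One_nat_def card_le_Suc0_iff_eq finite not_less_eq_eq numeral_2_eq_2)
  then have "c \<noteq> 1"
    using c[OF kl] inner_less_1[of "x $ k" "x $ l"] configurationsD[OF conf] by force
  then show "i \<in> I \<Longrightarrow> j \<in> I \<Longrightarrow> u i = u j"
    using equiangular_relation_constant[of I "($) x" c u i j] c zero configurationsD(1)[OF conf]
    by simp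
qed

text \<open>
  Among \<open>d + 2\<close> points there is a nonzero relation whose coefficient vanishes at one chosen point of the
  second class. Its coefficients are then zero on that class and a nonzero constant on the first.
\<close>

lemma orthogonal_simplex_pair_centroid:
  fixes x :: "(real ^ 'd) ^ 'n"
  assumes conf: "x \<in> configurations" and pair: "orthogonal_simplex_pair I x"
    and two: "2 \<le> card I" "2 \<le> card (- I)" and card: "CARD('n) = CARD('d) + 2"
  shows "(\<Sum>i\<in>I. x $ i) = 0"
proof -
  obtain k where "k \<in> - I"
    using two(2) by (metis card.empty ex_in_conv not_numeral_le_zero)
  obtain u where u: "u \<noteq> (\<lambda>i. 0)" "u k = 0" "(\<Sum>i\<in>UNIV. u i *\<^sub>R x $ i) = 0"
    using relation_vanishing_at[of k "($) x"] card by auto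
  have "u i = 0" if "i \<in> - I" for i
    using orthogonal_simplex_pair_relation(2)[of x "- I" u i k] conf pair two u that \<open>k \<in> - I\<close>
    by (simp add: orthogonal_simplex_pair_Compl)
  moreover obtain l where "u l \<noteq> 0"
    using u(1) by auto
  ultimately have l: "l \<in> I" "u l \<noteq> 0"
    by auto
  have "0 = (\<Sum>i\<in>I. u i *\<^sub>R x $ i)"
    using orthogonal_simplex_pair_relation(1)[OF conf pair two(1) u(3)] by simp
  also have "\<dots> = (\<Sum>i\<in>I. u l *\<^sub>R x $ i)"
  proof (intro sum.cong refl)
    fix i assume "i \<in> I"
    then have "u i = u l"
      using orthogonal_simplex_pair_relation(2)[OF conf pair two(1) u(3)] l(1) by blast
    then show "u i *\<^sub>R x $ i = u l *\<^sub>R x $ i" by simp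
  qed
  also have "\<dots> = u l *\<^sub>R (\<Sum>i\<in>I. x $ i)"
    by (simp add: scaleR_right.sum)
  finally show ?thesis using l(2) by simp
qed

text \<open>
  The inner product of two vertices of a regular simplex with \<open>m\<close> unit vertices that sum to \<open>0\<close>.
\<close>

definition simplex_cosine :: "nat \<Rightarrow> real" where
  "simplex_cosine m = - 1 / (real m - 1)"

lemma orthogonal_simplex_pair_inner:
  fixes x :: "(real ^ 'd) ^ 'n"
  assumes conf: "x \<in> configurations" and pair: "orthogonal_simplex_pair I x"
    and two: "2 \<le> card I" "2 \<le> card (- I)" and card: "CARD('n) = CARD('d) + 2"
    and ij: "i \<in> I" "j \<in> I" "i \<noteq> j"
  shows "x $ i \<bullet> x $ j = simplex_cosine (card I)"
proof -
  obtain c where c: "\<And>i j. i \<in> I \<Longrightarrow> j \<in> I \<Longrightarrow> i \<noteq> j \<Longrightarrow> x $ i \<bullet> x $ j = c"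
    using pair unfolding orthogonal_simplex_pair_def by metis
  have "0 = x $ i \<bullet> (\<Sum>j\<in>I. x $ j)"
    using orthogonal_simplex_pair_centroid[OF conf pair two card] by simp
  also have "\<dots> = x $ i \<bullet> x $ i + (\<Sum>j\<in>I - {i}. x $ i \<bullet> x $ j)"
    using ij(1) by (simp add: sum.remove[of I i] inner_add_right inner_sum_right)
  also have "(\<Sum>j\<in>I - {i}. x $ i \<bullet> x $ j) = (\<Sum>j\<in>I - {i}. c)"
    using c ij(1) by (intro sum.cong) auto
  also have "\<dots> = (real (card I) - 1) * c"
    using ij(1) two(1) by (simp add: card_Diff_singleton of_nat_diff)
  finally show ?thesis
    using c[OF ij] two(1) configurationsD(2)[OF conf, of i]
    by (simp add: simplex_cosine_def field_simps)
qed

lemma orthogonal_simplex_pair_gram: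
  fixes x :: "(real ^ 'd) ^ 'n"
  assumes conf: "x \<in> configurations" and pair: "orthogonal_simplex_pair I x"
    and two: "2 \<le> card I" "2 \<le> card (- I)" and card: "CARD('n) = CARD('d) + 2"
  shows "x $ i \<bullet> x $ j = (if i = j then 1
     else if i \<in> I \<and> j \<in> I then simplex_cosine (card I)
     else if i \<notin> I \<and> j \<notin> I then simplex_cosine (card (- I)) else 0)"
proof -
  have "x $ i \<bullet> x $ j = 0" if "i \<in> I \<longleftrightarrow> j \<notin> I"
    using pair that unfolding orthogonal_simplex_pair_def by (metis ComplI inner_commute)
  moreover have "x $ i \<bullet> x $ j = simplex_cosine (card I)" if "i \<in> I" "j \<in> I" "i \<noteq> j"
    using orthogonal_simplex_pair_inner[OF assms that] .
  moreover have "x $ i \<bullet> x $ j = simplex_cosine (card (- I))" if "i \<notin> I" "j \<notin> I" "i \<noteq> j"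
    using orthogonal_simplex_pair_inner[of x "- I" i j] assms that
    by (simp add: orthogonal_simplex_pair_Compl)
  ultimately show ?thesis
    using configurationsD(2)[OF conf] by auto
qed

text \<open>
  If some \<open>e \<noteq> 0\<close> were orthogonal to all points, adding \<open>e\<close> to a point of the first class would destroy
  the relation supported on that class, and then a relation that vanishes at a point of the second class
  could not exist. For \<open>d + 2\<close> vectors it always does.
\<close>

lemma orthogonal_simplex_pair_spans:
  fixes x :: "(real ^ 'd) ^ 'n"
  assumes conf: "x \<in> configurations" and pair: "orthogonal_simplex_pair I x"
    and two: "2 \<le> card I" "2 \<le> card (- I)" and card: "CARD('n) = CARD('d) + 2"
    and perp: "\<And>i. e \<bullet> x $ i = 0"
  shows "e = 0"
proof (rule ccontr)
  assume "e \<noteq> 0"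
  obtain k l where k: "k \<in> I" and l: "l \<in> - I"
    using two by (metis card.empty ex_in_conv not_numeral_le_zero)
  obtain u where u: "u \<noteq> (\<lambda>i. 0)" "u l = 0"
    and rel: "(\<Sum>i\<in>UNIV. u i *\<^sub>R (x $ i + (if i = k then e else 0))) = 0"
    using relation_vanishing_at[of l "\<lambda>i. x $ i + (if i = k then e else 0)"] card by auto
  have "(\<Sum>i\<in>UNIV. u i *\<^sub>R (x $ i + (if i = k then e else 0)))
      = (\<Sum>i\<in>UNIV. u i *\<^sub>R x $ i) + (\<Sum>i\<in>UNIV. if i = k then u k *\<^sub>R e else 0)"
    unfolding sum.distrib[symmetric] by (intro sum.cong) (auto simp: scaleR_right_distrib)
  then have split: "(\<Sum>i\<in>UNIV. u i *\<^sub>R x $ i) + u k *\<^sub>R e = 0"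
    using rel by simp
  have "e \<bullet> ((\<Sum>i\<in>UNIV. u i *\<^sub>R x $ i) + u k *\<^sub>R e) = u k * (e \<bullet> e)"
    by (simp add: inner_add_right inner_sum_right perp)
  then have "u k = 0"
    using split \<open>e \<noteq> 0\<close> by simp
  with split have rel': "(\<Sum>i\<in>UNIV. u i *\<^sub>R x $ i) = 0" by simp
  have "u i = 0" for i
  proof (cases "i \<in> I")
    case True
    then show ?thesis
      using orthogonal_simplex_pair_relation(2)[OF conf pair two(1) rel' _ k, of i] \<open>u k = 0\<close> by simp
  next
    case False
    then show ?thesis
      using orthogonal_simplex_pair_relation(2)[of x "- I" u i l] conf pair two rel' l u(2)
      by (simp add: orthogonal_simplex_pair_Compl)
  qed
  with u(1) show False by auto
qed

text \<open>
  Choose a basis among the vectors \<open>w i\<close> and extend the assignment linearly. The extension preserves the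
  inner product because it does so on the basis, and the difference \<open>T (w i) - x i\<close> is orthogonal to the
  image of the basis.
\<close>

lemma orthogonal_transformation_extends:
  fixes w x :: "'n \<Rightarrow> 'a::euclidean_space"
  assumes gram: "\<And>i j. w i \<bullet> w j = x i \<bullet> x j"
    and spans: "\<And>e. (\<And>i. e \<bullet> w i = 0) \<Longrightarrow> e = 0"
  obtains T where "orthogonal_transformation T" and "\<And>i. T (w i) = x i"
proof -
  have span_w: "span (range w) = UNIV"
  proof (rule ccontr)
    assume "span (range w) \<noteq> UNIV"
    then obtain e where "e \<noteq> 0" "\<And>y. y \<in> span (range w) \<Longrightarrow> e \<bullet> y = 0"
      using span_not_UNIV_orthogonal by blast
    then show False
      using spans[of e] span_base[of _ "range w"] by blast
  qed
  obtain B where B: "B \<subseteq> range w" "independent B" "range w \<subseteq> span B"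
    using maximal_independent_subset by blast
  have span_B: "span B = UNIV"
    using span_minimal[OF B(3) subspace_span] span_w by auto
  obtain T where T: "linear T" "\<And>b. b \<in> B \<Longrightarrow> T b = x (inv w b)"
    using linear_independent_extend[OF B(2), of "\<lambda>b. x (inv w b)"] by blast
  have on_B: "\<exists>i. b = w i \<and> T b = x i" if "b \<in> B" for b
    using T(2)[OF that] B(1) that by (metis f_inv_into_f subsetD)
  have T_inner: "T y \<bullet> T z = y \<bullet> z" for y z
  proof (rule bilinear_eq[of "\<lambda>y z. T y \<bullet> T z" "\<lambda>y z. y \<bullet> z" UNIV B UNIV B y z])
    show "bilinear (\<lambda>y z. T y \<bullet> T z)" "bilinear (\<lambda>y z :: 'a. y \<bullet> z)"
      using T(1) unfolding bilinear_def
      by (auto intro!: linearI simp: linear_add linear_scale inner_add_left inner_add_right)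
    show "T y \<bullet> T z = y \<bullet> z" if "y \<in> B" "z \<in> B" for y z
      using on_B[OF that(1)] on_B[OF that(2)] gram by auto
  qed (use span_B in auto)
  have ortho: "orthogonal_transformation T"
    using T(1) T_inner by (simp add: orthogonal_transformation_def)
  have "T (w i) = x i" for i
  proof -
    define e where "e = T (w i) - x i"
    have "B \<subseteq> {z. e \<bullet> T z = 0}"
    proof
      fix b assume "b \<in> B"
      then obtain j where j: "b = w j" "T b = x j" using on_B by blast
      have "e \<bullet> T b = T (w i) \<bullet> T (w j) - x i \<bullet> x j"
        using j by (simp add: e_def inner_diff_left)
      then show "b \<in> {z. e \<bullet> T z = 0}"
        by (simp add: T_inner gram)
    qed
    moreover have "subspace {z. e \<bullet> T z = 0}"
      using T(1) by (auto simp: subspace_def linear_0 linear_add linear_scale inner_add_right)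
    ultimately have "span B \<subseteq> {z. e \<bullet> T z = 0}"
      by (rule span_minimal)
    moreover obtain z where "T z = e"
      using orthogonal_transformation_surj[OF ortho] by (metis surjD)
    ultimately have "e \<bullet> T z = 0" "T z = e"
      using span_B by blast+
    then show ?thesis by (simp add: e_def)
  qed
  with ortho show ?thesis using that by blast
qed

text \<open>
  Label the points of \<open>W\<close> so that its two simplexes correspond to the classes of \<open>x\<close>. The two Gram
  matrices then agree.
\<close>

proposition two_orthogonal_simplexes_congruent:
  fixes x :: "(real ^ 'd) ^ 'n"
  assumes conf: "x \<in> configurations" and pair: "orthogonal_simplex_pair I x"
    and two: "2 \<le> card I" "2 \<le> card (- I)" and card: "CARD('n) = CARD('d) + 2"
    and W: "two_orthogonal_simplexes (card I) (card (- I)) W"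
  obtains T :: "real ^ 'd \<Rightarrow> real ^ 'd" where "orthogonal_transformation T" and "T ` W = range (($) x)"
proof -
  obtain Y Z where YZ: "W = Y \<union> Z" "Y \<subseteq> sphere 0 1" "Z \<subseteq> sphere 0 1"
      "regular_simplex (card I) Y" "regular_simplex (card (- I)) Z" "\<forall>y\<in>Y. \<forall>z\<in>Z. orthogonal y z"
    using W unfolding two_orthogonal_simplexes_def by blast
  then have card_YZ: "finite Y" "finite Z" "card Y = card I" "card Z = card (- I)"
    and W_sphere: "W \<subseteq> sphere 0 1"
    by (simp_all add: regular_simplex_def)
  have "y \<notin> Z" if "y \<in> Y" for y
  proof
    assume "y \<in> Z"
    then have "y \<bullet> y = 0" and "y \<in> sphere 0 1"
      using YZ that unfolding orthogonal_def by blast+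
    then show False by simp
  qed
  then have "Y \<inter> Z = {}" by blast
  then have "card W = card I + card (- I)"
    using card_YZ by (simp add: YZ(1) card_Un_disjoint)
  also have "\<dots> = CARD('n)"
    using card_Un_disjoint[of I "- I"] by simp
  finally have "card W = CARD('n)" .
  moreover have "finite W" using YZ(1) card_YZ by simp
  ultimately obtain f :: "'n \<Rightarrow> real ^ 'd" where f: "bij_betw f UNIV W"
    using finite_same_card_bij[of "UNIV :: 'n set" W] by auto
  define w where "w = (\<chi> i. f i)"
  have w_eq: "($) w = f" by (auto simp: w_def)
  have conf_w: "w \<in> configurations" and range_w: "range (($) w) = W"
    using f W_sphere by (auto simp: configurations_def w_eq bij_betw_def)
  obtain J where J: "orthogonal_simplex_pair J w" "card J = card I" "card (- J) = card (- I)"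
    using W two_orthogonal_simplexes_range_iff[OF conf_w] range_w by blast
  obtain p q where p: "bij_betw p I J" and q: "bij_betw q (- I) (- J)"
    using finite_same_card_bij[of I J] finite_same_card_bij[of "- I" "- J"] J by auto
  define \<pi> where "\<pi> = (\<lambda>i. if i \<in> I then p i else q i)"
  have "bij_betw \<pi> (I \<union> - I) (J \<union> - J)"
    unfolding \<pi>_def using p q by (intro bij_betw_disjoint_Un) auto
  then have "bij \<pi>" by simp
  have \<pi>_mem: "\<pi> i \<in> J \<longleftrightarrow> i \<in> I" for i
    using bij_betwE[OF p] bij_betwE[OF q] by (auto simp: \<pi>_def)
  have \<pi>_eq: "\<pi> i = \<pi> j \<longleftrightarrow> i = j" for i j
    using \<open>bij \<pi>\<close> by (auto simp: bij_def inj_def)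
  have "w $ \<pi> i \<bullet> w $ \<pi> j = x $ i \<bullet> x $ j" for i j
    using orthogonal_simplex_pair_gram[OF conf pair two card, of i j]
      orthogonal_simplex_pair_gram[OF conf_w J(1) _ _ card, of "\<pi> i" "\<pi> j"] two J(2,3)
    by (simp add: \<pi>_mem \<pi>_eq)
  moreover have "e = 0" if "\<And>i. e \<bullet> w $ \<pi> i = 0" for e
  proof (rule orthogonal_simplex_pair_spans[OF conf_w J(1) _ _ card])
    show "e \<bullet> w $ i = 0" for i
      using that \<open>bij \<pi>\<close> by (metis bij_pointE)
  qed (use two J in simp_all)
  ultimately obtain T where T: "orthogonal_transformation T" "\<And>i. T (w $ \<pi> i) = x $ i"
    using orthogonal_transformation_extends[of "\<lambda>i. w $ \<pi> i" "($) x"] by blast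
  have "W = range (\<lambda>i. w $ \<pi> i)"
    using bij_is_surj[OF \<open>bij \<pi>\<close>] unfolding range_w[symmetric]
    by (metis (no_types) image_image)
  then have "T ` W = range (($) x)"
    using T(2) by (simp add: image_image)
  with T(1) show ?thesis using that by blast
qed

section \<open>The energy as a function of the two sizes\<close>

text \<open>
  The sum of \<open>ln (|y - z|\<^sup>2 / 2)\<close> over the ordered pairs of distinct vertices of a centred regular simplex
  with \<open>t\<close> unit vertices, which is \<open>t * (t - 1) * ln (t / (t - 1))\<close>. It compares such a simplex with
  pairwise orthogonal vectors and is extended to real \<open>t\<close> for the sake of concavity.
\<close>

definition simplex_gain :: "real \<Rightarrow> real" where
  "simplex_gain t = t * (t - 1) * (ln t - ln (t - 1))"

lemma log_energy_simplex_pair: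
  fixes x :: "(real ^ 'd) ^ 'n"
  assumes conf: "x \<in> configurations" and pair: "orthogonal_simplex_pair I x"
    and two: "2 \<le> card I" "2 \<le> card (- I)" and card: "CARD('n) = CARD('d) + 2"
  shows "log_energy x = - (1/2) * (real CARD('n) * (real CARD('n) - 1) * ln 2
    + simplex_gain (card I) + simplex_gain (card (- I)))"
proof -
  define edge where "edge = (\<lambda>J :: 'n set. ln (real (card J)) - ln (real (card J) - 1))"
  have half_sum: "(\<Sum>j\<in>-{i}. - (1/2) * ln (2 - 2 * (x $ i \<bullet> x $ j)))
      = - (1/2) * ((real CARD('n) - 1) * ln 2 + (real (card J) - 1) * edge J)"
    if J: "J = I \<or> J = - I" and i: "i \<in> J" for i J
  proof -
    have "2 \<le> card J" using J two by auto
    have "- (1/2) * ln (2 - 2 * (x $ i \<bullet> x $ j)) = - (1/2) * ln 2 - (1/2) * (if j \<in> J then edge J else 0)"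
      if "j \<in> -{i}" for j
    proof (cases "j \<in> J")
      case True
      then have "x $ i \<bullet> x $ j = simplex_cosine (card J)"
        using orthogonal_simplex_pair_gram[OF assms, of i j] J i that by auto
      then have "2 - 2 * (x $ i \<bullet> x $ j) = 2 * (real (card J) / (real (card J) - 1))"
        using \<open>2 \<le> card J\<close> by (simp add: simplex_cosine_def field_simps)
      then have "ln (2 - 2 * (x $ i \<bullet> x $ j)) = ln 2 + edge J"
        using \<open>2 \<le> card J\<close> True unfolding edge_def by (auto simp: ln_mult_pos ln_div)
      then show ?thesis using True by (simp add: add_divide_distrib)
    next
      case False
      then have "x $ i \<bullet> x $ j = 0"
        using orthogonal_simplex_pair_gram[OF assms, of i j] J i that by auto
      then show ?thesis using False by simp
    qed
    then have "(\<Sum>j\<in>-{i}. - (1/2) * ln (2 - 2 * (x $ i \<bullet> x $ j)))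
        = (\<Sum>j\<in>-{i}. - (1/2) * ln 2 - (1/2) * (if j \<in> J then edge J else 0))"
      by (rule sum.cong[OF refl])
    also have "\<dots> = - (1/2) * (real CARD('n) - 1) * ln 2 - (1/2) * (\<Sum>j\<in>-{i}. if j \<in> J then edge J else 0)"
      by (simp add: sum_subtractf sum_distrib_left card_except)
    also have "(\<Sum>j\<in>-{i}. if j \<in> J then edge J else 0) = (real (card J) - 1) * edge J"
      using i by (simp add: sum_except sum.If_cases algebra_simps)
    also have "- (1/2) * (real CARD('n) - 1) * ln 2 - (1/2) * ((real (card J) - 1) * edge J)
        = - (1/2) * ((real CARD('n) - 1) * ln 2 + (real (card J) - 1) * edge J)"
      by (simp add: field_simps)
    finally show ?thesis .
  qed
  have "log_energy x = (\<Sum>i\<in>UNIV. if i \<in> I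
      then - (1/2) * ((real CARD('n) - 1) * ln 2 + (real (card I) - 1) * edge I)
      else - (1/2) * ((real CARD('n) - 1) * ln 2 + (real (card (- I)) - 1) * edge (- I)))"
    unfolding log_energy_eq_inner[OF conf] by (intro sum.cong refl) (use half_sum in auto)
  also have "\<dots> = card I * (- (1/2) * ((real CARD('n) - 1) * ln 2 + (real (card I) - 1) * edge I))
      + card (- I) * (- (1/2) * ((real CARD('n) - 1) * ln 2 + (real (card (- I)) - 1) * edge (- I)))"
    by (simp add: sum.If_cases Collect_neg_eq)
  also have "\<dots> = - (1/2) * ((real (card I) + real (card (- I))) * (real CARD('n) - 1) * ln 2
    + simplex_gain (card I) + simplex_gain (card (- I)))"
    by (simp add: simplex_gain_def edge_def algebra_simps)
  also have "real (card I) + real (card (- I)) = real CARD('n)"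
    using card_Un_disjoint[of I "- I"] by simp
  finally show ?thesis .
qed

lemma ln_less_half_diff_inverse:
  assumes "1 < (y :: real)"
  shows "ln y < (y - 1 / y) / 2"
proof -
  have "(\<lambda>t. (t - 1 / t) / 2 - ln t) 1 < (\<lambda>t. (t - 1 / t) / 2 - ln t) y"
  proof (rule DERIV_pos_imp_increasing_open[OF assms])
    fix t :: real assume t: "1 < t" "t < y"
    have "((\<lambda>t. (t - 1 / t) / 2 - ln t) has_real_derivative (1 - 1 / t)\<^sup>2 / 2) (at t)"
      using t by (auto intro!: derivative_eq_intros simp: power2_eq_square field_simps)
    moreover have "0 < (1 - 1 / t)\<^sup>2 / 2"
      using t by simp
    ultimately show "\<exists>d. ((\<lambda>t. (t - 1 / t) / 2 - ln t) has_real_derivative d) (at t) \<and> 0 < d"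
      by blast
  qed (auto intro!: continuous_intros)
  then show ?thesis by simp
qed

definition simplex_gain_deriv :: "real \<Rightarrow> real" where
  "simplex_gain_deriv t = (2 * t - 1) * (ln t - ln (t - 1)) - 1"

lemma simplex_gain_has_derivative:
  assumes "1 < t"
  shows "(simplex_gain has_real_derivative simplex_gain_deriv t) (at t)"
proof -
  have "((\<lambda>t. t * (t - 1) * (ln t - ln (t - 1))) has_real_derivative
      (2 * t - 1) * (ln t - ln (t - 1)) + t * (t - 1) * (1 / t - 1 / (t - 1))) (at t)"
    using assms by (auto intro!: derivative_eq_intros simp: algebra_simps divide_inverse)
  moreover have "t * (t - 1) * (1 / t - 1 / (t - 1)) = - 1"
    using assms by (simp add: field_simps)
  ultimately show ?thesis
    by (simp add: simplex_gain_def[abs_def] simplex_gain_deriv_def)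
qed

text \<open>
  The second derivative is \<open>2 * ln y - (y - 1 / y)\<close> for \<open>y = r / (r - 1)\<close>.
\<close>

lemma simplex_gain_deriv_decreasing:
  assumes "1 < s" and "s < t"
  shows "simplex_gain_deriv t < simplex_gain_deriv s"
proof (rule DERIV_neg_imp_decreasing[OF assms(2)])
  fix r assume "s \<le> r" "r \<le> t"
  then have r: "1 < r" using assms by simp
  have "(simplex_gain_deriv has_real_derivative
      2 * (ln r - ln (r - 1)) + (2 * r - 1) * (1 / r - 1 / (r - 1))) (at r)"
    unfolding simplex_gain_deriv_def[abs_def] using r
    by (auto intro!: derivative_eq_intros simp: algebra_simps divide_inverse)
  moreover have "2 * (ln r - ln (r - 1)) < r / (r - 1) - (r - 1) / r"
    using ln_less_half_diff_inverse[of "r / (r - 1)"] r by (simp add: ln_div)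
  moreover have "(2 * r - 1) * (1 / r - 1 / (r - 1)) = - (r / (r - 1) - (r - 1) / r)"
    using r by (simp add: divide_simps) (simp add: algebra_simps)
  ultimately show "\<exists>d. (simplex_gain_deriv has_real_derivative d) (at r) \<and> d < 0"
    by (intro exI conjI) (assumption, simp)
qed

text \<open>
  By the mean value theorem both differences over unit steps are values of the decreasing derivative,
  one taken above \<open>m - 1\<close> and the other below \<open>n + 1 \<le> m - 1\<close>.
\<close>

lemma simplex_gain_balancing:
  assumes "1 < n" and "n + 2 \<le> m"
  shows "simplex_gain m + simplex_gain n < simplex_gain (m - 1) + simplex_gain (n + 1)"
proof -
  obtain z where z: "m - 1 < z" "z < m"
      "simplex_gain m - simplex_gain (m - 1) = (m - (m - 1)) * simplex_gain_deriv z"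
    using MVT2[of "m - 1" m simplex_gain simplex_gain_deriv] simplex_gain_has_derivative assms by force
  obtain y where y: "n < y" "y < n + 1"
      "simplex_gain (n + 1) - simplex_gain n = (n + 1 - n) * simplex_gain_deriv y"
    using MVT2[of n "n + 1" simplex_gain simplex_gain_deriv] simplex_gain_has_derivative assms by force
  have "simplex_gain_deriv z < simplex_gain_deriv y"
    using simplex_gain_deriv_decreasing[of y z] y z assms by simp
  then show ?thesis using y z by simp
qed

section \<open>Existence of simplex pairs and of global minima\<close>

lemma isometry_inner:
  fixes f :: "'a::real_inner \<Rightarrow> 'b::real_inner"
  assumes "linear f" and "subspace S" and norm: "\<And>z. z \<in> S \<Longrightarrow> norm (f z) = norm z"
    and "y \<in> S" and "z \<in> S"
  shows "f y \<bullet> f z = y \<bullet> z"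
proof -
  have "norm (f y + f z) = norm (y + z)"
    using assms subspace_add[OF assms(2,4,5)] by (metis linear_add)
  then show ?thesis
    using norm[of y] norm[of z] assms by (simp add: dot_norm)
qed

text \<open>
  The unit coordinate vectors of an \<open>N\<close>-dimensional space, each with the centroid of its class
  subtracted, form two orthogonal simplexes. They lie in the orthogonal complement \<open>S\<close> of the indicator
  vectors of the two classes; it has dimension \<open>N - 2 = d\<close> and can be mapped isometrically onto the
  \<open>d\<close>-dimensional space.
\<close>

proposition orthogonal_simplex_pair_exists:
  assumes card: "CARD('n::finite) = CARD('d::finite) + 2"
    and two: "2 \<le> card I" "2 \<le> card (- I)"
  obtains x :: "(real ^ 'd) ^ 'n" where "x \<in> configurations" and "orthogonal_simplex_pair I x"
proof -
  define e :: "'n set \<Rightarrow> real ^ 'n" where "e = (\<lambda>J. \<chi> j. if j \<in> J then 1 else 0)"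
  define K where "K = (\<lambda>i. if i \<in> I then I else - I)"
  define k where "k = (\<lambda>i. real (card (K i)))"
  define z where "z = (\<lambda>i. axis i 1 - (1 / k i) *\<^sub>R e (K i))"
  define A where "A = span {e I, e (- I)}"
  define S where "S = {y \<in> UNIV. \<forall>a\<in>A. orthogonal a y}"
  have k: "2 \<le> k i" for i
    using two by (simp add: k_def K_def)
  have inner_e: "e J \<bullet> e J' = card (J \<inter> J')" for J J'
    by (simp add: e_def inner_vec_def if_distrib[of "\<lambda>a. a * _"] sum.If_cases cong: if_cong)
  have inner_axis: "axis i 1 \<bullet> e J = (if i \<in> J then 1 else 0)" for i J
    by (simp add: e_def inner_axis')
  have inner_z_e: "z i \<bullet> e J = 0" if "J = I \<or> J = - I" for i J
    using that k[of i] by (auto simp: z_def inner_diff_left inner_axis inner_e k_def K_def)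
  have inner_z: "z i \<bullet> z j = (if i = j then 1 else 0) - (if K i = K j then 1 / k i else 0)" for i j
  proof -
    have "z j = axis j 1 - (1 / k j) *\<^sub>R e (K j)"
      by (simp add: z_def)
    then have "z i \<bullet> z j = z i \<bullet> axis j 1 - (1 / k j) * (z i \<bullet> e (K j))"
      by (simp only: inner_diff_right inner_scaleR_right)
    also have "z i \<bullet> e (K j) = 0"
      by (rule inner_z_e) (simp add: K_def)
    also have "z i \<bullet> axis j 1 = (if i = j then 1 else 0) - (1 / k i) * (if j \<in> K i then 1 else 0)"
      unfolding z_def inner_diff_left
      by (simp add: inner_commute[of "e _"] inner_axis inner_axis_axis)
    also have "j \<in> K i \<longleftrightarrow> K i = K j"
      by (auto simp: K_def)
    finally show ?thesis by simp
  qed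
  have z_S: "z i \<in> S" for i
  proof -
    have "A \<subseteq> {a. a \<bullet> z i = 0}"
      unfolding A_def
    proof (rule span_minimal)
      show "{e I, e (- I)} \<subseteq> {a. a \<bullet> z i = 0}"
        using inner_z_e[of _ i] by (auto simp: inner_commute[of "e _"])
      show "subspace {a. a \<bullet> z i = 0}"
        by (auto simp: subspace_def inner_add_left)
    qed
    then show ?thesis by (auto simp: S_def orthogonal_def)
  qed
  have "dim A = 2"
  proof -
    have "e I \<bullet> e (- I) = 0" by (simp add: inner_e)
    moreover have nz: "e I \<noteq> 0" "e (- I) \<noteq> 0"
      using inner_e[of I I] inner_e[of "- I" "- I"] two by (metis Int_absorb inner_zero_left
          not_numeral_le_zero of_nat_eq_0_iff)+
    ultimately have "e I \<noteq> e (- I)" by (metis inner_eq_zero_iff)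
    moreover have "independent {e I, e (- I)}"
      using \<open>e I \<bullet> e (- I) = 0\<close> nz
      by (intro pairwise_orthogonal_independent) (auto simp: pairwise_def orthogonal_def inner_commute)
    ultimately show ?thesis
      by (simp add: A_def dim_eq_card_independent)
  qed
  moreover have "dim S + dim A = CARD('n)"
    using dim_subspace_orthogonal_to_vectors[of A UNIV] by (simp add: S_def A_def)
  ultimately have "dim S = dim (UNIV :: (real ^ 'd) set)"
    using card by simp
  moreover have "subspace S"
    by (auto simp: S_def subspace_def orthogonal_clauses)
  ultimately obtain f :: "real ^ 'n \<Rightarrow> real ^ 'd"
    where f: "linear f" "\<And>y. y \<in> S \<Longrightarrow> norm (f y) = norm y"
    using isometries_subspaces[of S "UNIV :: (real ^ 'd) set"] by (metis subspace_UNIV)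
  have inner_f: "f (z i) \<bullet> f (z j) = z i \<bullet> z j" for i j
    using isometry_inner[OF f(1) \<open>subspace S\<close> f(2)] z_S by blast
  define x where "x = (\<chi> i. (1 / norm (z i)) *\<^sub>R f (z i))"
  have inner_x: "x $ i \<bullet> x $ j = (z i \<bullet> z j) / (norm (z i) * norm (z j))" for i j
    by (simp add: x_def inner_f)
  have norm_z: "(norm (z i))\<^sup>2 = 1 - 1 / k i" "0 < norm (z i)" for i
  proof -
    show *: "(norm (z i))\<^sup>2 = 1 - 1 / k i"
      using inner_z[of i i] by (simp add: power2_norm_eq_inner)
    have "0 < 1 - 1 / k i" using k[of i] by (simp add: field_simps)
    then show "0 < norm (z i)" using * by (metis norm_zero power_zero_numeral zero_less_norm_iff less_irrefl)
  qed
  have unit: "norm (x $ i) = 1" for i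
    using inner_x[of i i] norm_z(2)[of i]
    by (simp add: norm_eq_1 power2_norm_eq_inner[symmetric] power2_eq_square)
  have nonpos: "x $ i \<bullet> x $ j \<le> 0" if "i \<noteq> j" for i j
    using inner_z[of i j] that k[of i] norm_z(2)[of i] norm_z(2)[of j]
    by (simp add: inner_x divide_nonpos_pos)
  have "x $ i \<noteq> x $ j" if "i \<noteq> j" for i j
  proof
    assume "x $ i = x $ j"
    then have "x $ i \<bullet> x $ j = 1" using unit[of j] by (simp add: norm_eq_1)
    with nonpos[OF that] show False by simp
  qed
  then have "x \<in> configurations"
    using unit by (intro configurationsI)
  moreover have "orthogonal_simplex_pair I x"
    unfolding orthogonal_simplex_pair_def
  proof (intro conjI)
    show "\<forall>i\<in>I. \<forall>j\<in>-I. x $ i \<bullet> x $ j = 0"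
      using inner_z two by (auto simp: inner_x K_def)
    have same: "x $ i \<bullet> x $ j = - (1 / card J) / (1 - 1 / card J)"
      if "J = I \<or> J = - I" "i \<in> J" "j \<in> J" "i \<noteq> j" for i j J
    proof -
      have "K i = J" "K j = J" using that by (auto simp: K_def)
      then have "(norm (z i))\<^sup>2 = (norm (z j))\<^sup>2"
        by (simp only: norm_z(1) k_def)
      then have "norm (z i) = norm (z j)"
        by (rule power2_eq_imp_eq) simp_all
      then show ?thesis
        using inner_z[of i j] norm_z(1)[of j] that \<open>K i = J\<close> \<open>K j = J\<close>
        by (simp add: inner_x k_def power2_eq_square)
    qed
    show "\<exists>c. \<forall>i\<in>I. \<forall>j\<in>I. i \<noteq> j \<longrightarrow> x $ i \<bullet> x $ j = c"
      using same by blast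
    show "\<exists>c. \<forall>i\<in>-I. \<forall>j\<in>-I. i \<noteq> j \<longrightarrow> x $ i \<bullet> x $ j = c"
      using same by blast
  qed
  ultimately show ?thesis using that by blast
qed

text \<open>
  The energy is minus the logarithm of the product of all distances. This product is continuous on the
  compact set of all tuples of unit vectors, coincidences included, and where it is largest it is
  positive, so the points there are distinct.
\<close>

proposition log_global_minimum_exists:
  assumes "(configurations :: ((real ^ 'd) ^ 'n) set) \<noteq> {}"
  obtains x :: "(real ^ 'd) ^ 'n" where "log_global_minimum x"
proof -
  define S :: "((real ^ 'd) ^ 'n) set" where "S = {x. \<forall>i. norm (x $ i) = 1}"
  define P :: "(real ^ 'd) ^ 'n \<Rightarrow> real" where "P = (\<lambda>x. \<Prod>(i, j)\<in>{(i, j). i \<noteq> j}. dist (x $ i) (x $ j))"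
  have conf_S: "configurations \<subseteq> S"
    by (auto simp: S_def configurationsD)
  have "closed S"
    unfolding S_def by (intro closed_Collect_all closed_Collect_eq continuous_intros)
  moreover have "bounded S"
  proof (rule boundedI)
    fix x assume "x \<in> S"
    have "norm x \<le> (\<Sum>i\<in>UNIV. norm (x $ i))"
      unfolding norm_vec_def by (rule L2_set_le_sum) simp
    also have "\<dots> = real CARD('n)"
      using \<open>x \<in> S\<close> by (simp add: S_def)
    finally show "norm x \<le> real CARD('n)" .
  qed
  ultimately have "compact S"
    by (simp add: compact_eq_bounded_closed)
  moreover have "continuous_on S P"
    unfolding P_def by (auto intro!: continuous_intros simp: case_prod_beta)
  moreover obtain w where w: "w \<in> (configurations :: ((real ^ 'd) ^ 'n) set)"
    using assms by blast
  ultimately obtain x where x: "x \<in> S" "\<And>y. y \<in> S \<Longrightarrow> P y \<le> P x"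
    using continuous_attains_sup[of S P] conf_S by blast
  have P_pos: "0 < P y" if "y \<in> configurations" for y
    unfolding P_def using configurationsD(3)[OF that] by (intro prod_pos) auto
  have energy: "log_energy y = - ln (P y)" if "y \<in> configurations" for y
  proof -
    have "ln (P y) = (\<Sum>(i, j)\<in>{(i, j). i \<noteq> j}. ln (dist (y $ i) (y $ j)))"
      unfolding P_def using configurationsD(3)[OF that]
      by (subst ln_prod) (auto simp: case_prod_beta intro!: sum.cong)
    moreover have "log_energy y = (\<Sum>(i, j)\<in>{(i, j). i \<noteq> j}. - ln (dist (y $ i) (y $ j)))"
      unfolding log_energy_def using configurationsD(3)[OF that]
      by (intro sum.cong) (auto simp: ln_div)
    ultimately show ?thesis
      by (simp add: sum_negf case_prod_beta)
  qed
  have "0 < P x"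
    using P_pos[OF w] x(2)[of w] w conf_S by force
  have distinct: "x $ i \<noteq> x $ j" if "i \<noteq> j" for i j
  proof
    assume "x $ i = x $ j"
    then have "P x = 0"
      unfolding P_def using that by (intro prod_zero bexI[of _ "(i, j)"]) auto
    with \<open>0 < P x\<close> show False by simp
  qed
  have conf: "x \<in> configurations"
    using x(1) distinct by (intro configurationsI) (auto simp: S_def)
  have "log_energy x \<le> log_energy y" if "y \<in> configurations" for y :: "(real ^ 'd) ^ 'n"
    using x(2)[of y] P_pos[OF that] P_pos[OF conf] that conf_S
    by (auto simp: energy[OF that] energy[OF conf])
  then have "log_global_minimum x"
    unfolding log_global_minimum_def is_arg_min_def using conf by (auto simp: not_less)
  then show ?thesis using that by blast
qed

section \<open>Classification of the minima\<close>

lemma log_global_minimum_imp_local: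
  fixes x :: "(real ^ 'd) ^ 'n"
  assumes "log_global_minimum x"
  shows "log_local_minimum x"
proof -
  have "x \<in> configurations \<and> 
      (\<forall>y \<in> (configurations :: ((real ^ 'd) ^ 'n) set). log_energy x \<le> log_energy y)"
    using assms by (auto simp: log_global_minimum_def is_arg_min_def not_less)
  then show ?thesis
    unfolding log_local_minimum_def by (auto simp: eventually_at_filter)
qed

lemma local_minimum_larger_simplex:
  fixes x :: "(real ^ 'd) ^ 'n"
  assumes min: "log_local_minimum x" and card: "CARD('n) = CARD('d) + 2"
  obtains I where "orthogonal_simplex_pair I x" and "card (- I) \<le> card I" and "2 \<le> card (- I)"
    and "card I + card (- I) = CARD('d) + 2"
proof -
  obtain J where J: "orthogonal_simplex_pair J x" "2 \<le> card J" "2 \<le> card (- J)"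
    using local_minimum_simplex_pair[OF min card] .
  have total: "card J + card (- J) = CARD('d) + 2"
    using card_Un_disjoint[of J "- J"] card by simp
  show ?thesis
  proof (cases "card (- J) \<le> card J")
    case True
    then show ?thesis using that[of J] J total by simp
  next
    case False
    then show ?thesis using that[of "- J"] J total by (simp add: orthogonal_simplex_pair_Compl)
  qed
qed

text \<open>
  Otherwise the pair in which one vertex has passed from the larger simplex to the smaller one would
  have less energy.
\<close>

proposition global_minimum_balanced:
  fixes x :: "(real ^ 'd) ^ 'n"
  assumes min: "log_global_minimum x" and card: "CARD('n) = CARD('d) + 2"
    and pair: "orthogonal_simplex_pair I x" and two: "2 \<le> card I" "2 \<le> card (- I)"
  shows "card I \<le> card (- I) + 1"
proof (rule ccontr)
  assume "\<not> card I \<le> card (- I) + 1"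
  then have gap: "card (- I) + 2 \<le> card I" by simp
  have conf: "x \<in> configurations"
    using min by (simp add: log_global_minimum_def is_arg_min_def)
  obtain k where "k \<in> I"
    using two(1) by (metis card.empty ex_in_conv not_numeral_le_zero)
  define J where "J = I - {k}"
  have card_J: "card J = card I - 1" "card (- J) = card (- I) + 1"
    using \<open>k \<in> I\<close> by (simp_all add: J_def card_Diff_singleton Compl_Diff_eq)
  then have two_J: "2 \<le> card J" "2 \<le> card (- J)"
    using gap two by simp_all
  obtain y :: "(real ^ 'd) ^ 'n" where y: "y \<in> configurations" "orthogonal_simplex_pair J y"
    using orthogonal_simplex_pair_exists[OF card two_J] .
  have "simplex_gain (card I) + simplex_gain (card (- I)) < simplex_gain (card J) + simplex_gain (card (- J))"
    using simplex_gain_balancing[of "card (- I)" "card I"] gap two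
    by (simp add: card_J of_nat_diff add.commute)
  then have "log_energy y < log_energy x"
    using log_energy_simplex_pair[OF conf pair two card] log_energy_simplex_pair[OF y two_J card]
    by simp
  with min y(1) show False
    by (auto simp: log_global_minimum_def is_arg_min_def)
qed

theorem theorem1p1:
  assumes "CARD('d::finite) \<ge> 2"
    and "CARD('n::finite) = CARD('d) + 2"
  shows "(\<forall>x :: (real ^ 'd) ^ 'n. log_local_minimum x \<longrightarrow>
            (\<exists>m n. m \<ge> n \<and> n > 1 \<and> m + n = CARD('d) + 2 \<and>
               two_orthogonal_simplexes m n (range (($) x)) \<and>
               (\<forall>W :: (real ^ 'd) set. two_orthogonal_simplexes m n W \<longrightarrow>
                  (\<exists>T :: real ^ 'd \<Rightarrow> real ^ 'd. orthogonal_transformation T \<and> T ` W = range (($) x)))))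
       \<and> (\<exists>x :: (real ^ 'd) ^ 'n. log_global_minimum x)
       \<and> (\<forall>x \<in> (configurations :: ((real ^ 'd) ^ 'n) set). log_global_minimum x \<longleftrightarrow>
            (\<exists>m n. m \<ge> n \<and> n > 1 \<and> m + n = CARD('d) + 2 \<and>
               (if even (CARD('d)) then m = n else m = n + 1) \<and>
               two_orthogonal_simplexes m n (range (($) x))))"
proof (intro conjI allI impI ballI)
  fix x :: "(real ^ 'd) ^ 'n"
  assume min: "log_local_minimum x"
  then have conf: "x \<in> configurations"
    by (simp add: log_local_minimum_def)
  obtain I where I: "orthogonal_simplex_pair I x" "card (- I) \<le> card I" "2 \<le> card (- I)"
      "card I + card (- I) = CARD('d) + 2"
    using local_minimum_larger_simplex[OF min assms(2)] .
  show "\<exists>m n. m \<ge> n \<and> n > 1 \<and> m + n = CARD('d) + 2 \<and>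
      two_orthogonal_simplexes m n (range (($) x)) \<and>
      (\<forall>W :: (real ^ 'd) set. two_orthogonal_simplexes m n W \<longrightarrow>
        (\<exists>T :: real ^ 'd \<Rightarrow> real ^ 'd. orthogonal_transformation T \<and> T ` W = range (($) x)))"
  proof (rule exI[of _ "card I"], rule exI[of _ "card (- I)"], intro conjI allI impI)
    show "two_orthogonal_simplexes (card I) (card (- I)) (range (($) x))"
      using two_orthogonal_simplexes_range_iff[OF conf] I(1) by blast
    fix W :: "(real ^ 'd) set"
    assume "two_orthogonal_simplexes (card I) (card (- I)) W"
    then show "\<exists>T :: real ^ 'd \<Rightarrow> real ^ 'd. orthogonal_transformation T \<and> T ` W = range (($) x)"
      using two_orthogonal_simplexes_congruent[OF conf I(1) _ I(3) assms(2)] I(2,3)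
      by (metis le_trans)
  qed (use I in simp_all)
next
  obtain I :: "'n set" where "card I = 2"
    using obtain_subset_with_card_n[of 2 "UNIV :: 'n set"] assms(2) by auto
  moreover from this have "card (- I) = CARD('d)"
    using card_Un_disjoint[of I "- I"] assms(2) by simp
  ultimately obtain y :: "(real ^ 'd) ^ 'n" where "y \<in> configurations"
    using orthogonal_simplex_pair_exists[OF assms(2), of I] assms(1) by auto
  then obtain x0 :: "(real ^ 'd) ^ 'n" where x0: "log_global_minimum x0"
    using log_global_minimum_exists by blast
  then show "\<exists>x :: (real ^ 'd) ^ 'n. log_global_minimum x" by blast
  have balanced: "\<exists>I. orthogonal_simplex_pair I x \<and> 1 < card (- I) \<and> card I + card (- I) = CARD('d) + 2 \<and>
      (if even (CARD('d)) then card I = card (- I) else card I = card (- I) + 1)"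
    if min: "log_global_minimum x" for x :: "(real ^ 'd) ^ 'n"
  proof -
    obtain I where I: "orthogonal_simplex_pair I x" "card (- I) \<le> card I" "2 \<le> card (- I)"
        "card I + card (- I) = CARD('d) + 2"
      using local_minimum_larger_simplex[OF log_global_minimum_imp_local[OF min] assms(2)] .
    have "card I \<le> card (- I) + 1"
      using global_minimum_balanced[OF min assms(2) I(1)] I(2,3) by simp
    then have "card I = card (- I) \<or> card I = card (- I) + 1"
      using I(2) by linarith
    moreover have "even (CARD('d)) \<longleftrightarrow> even (card I + card (- I))"
      using I(4) by simp
    ultimately have "if even (CARD('d)) then card I = card (- I) else card I = card (- I) + 1"
      by auto
    then show ?thesis using I by (intro exI[of _ I]) simp
  qed
  fix x :: "(real ^ 'd) ^ 'n"
  assume conf: "x \<in> configurations"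
  show "log_global_minimum x \<longleftrightarrow>
      (\<exists>m n. m \<ge> n \<and> n > 1 \<and> m + n = CARD('d) + 2 \<and>
         (if even (CARD('d)) then m = n else m = n + 1) \<and>
         two_orthogonal_simplexes m n (range (($) x)))" (is "_ \<longleftrightarrow> ?balanced")
  proof
    assume "log_global_minimum x"
    then obtain I where I: "orthogonal_simplex_pair I x" "1 < card (- I)"
        "card I + card (- I) = CARD('d) + 2"
        "if even (CARD('d)) then card I = card (- I) else card I = card (- I) + 1"
      using balanced by blast
    have "two_orthogonal_simplexes (card I) (card (- I)) (range (($) x))"
      using two_orthogonal_simplexes_range_iff[OF conf] I(1) by blast
    then show ?balanced
      using I by (intro exI[of _ "card I"] exI[of _ "card (- I)"]) (auto split: if_splits)
  next
    assume ?balanced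
    then obtain m n where mn: "m \<ge> n" "n > 1" "m + n = CARD('d) + 2"
        "if even (CARD('d)) then m = n else m = n + 1"
        "two_orthogonal_simplexes m n (range (($) x))"
      by blast
    then obtain I where I: "orthogonal_simplex_pair I x" "card I = m" "card (- I) = n"
      using two_orthogonal_simplexes_range_iff[OF conf] by blast
    obtain J where J: "orthogonal_simplex_pair J x0" "1 < card (- J)"
        "card J + card (- J) = CARD('d) + 2"
        "if even (CARD('d)) then card J = card (- J) else card J = card (- J) + 1"
      using balanced[OF x0] by blast
    have conf0: "x0 \<in> configurations"
      using x0 by (simp add: log_global_minimum_def is_arg_min_def)
    have "card J = m" "card (- J) = n"
      using J(3,4) mn(3,4) by (auto split: if_splits)
    then have "log_energy x = log_energy x0"
      using log_energy_simplex_pair[OF conf I(1) _ _ assms(2)]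
        log_energy_simplex_pair[OF conf0 J(1) _ _ assms(2)] I mn(1,2) by simp
    with x0 conf show "log_global_minimum x"
      by (simp add: log_global_minimum_def is_arg_min_def)
  qed
qed

end
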